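(* Let $h>0$, $\Omega=\{(x_1,x_2)\in\mathbb{R}^2: 0<x_2<x_1<h\}$ (an isosceles right triangle) and $\Gamma=\{x_1=h,\ x_2\in[0,h]\}$ (a leg). Then the sharp constant $C_2(\Omega,\Gamma)$ is equal to $$\left(\frac{\widehat z_0}h\tanh(\widehat z_0)\right)^{-\frac12},$$ where $\widehat z_0\approx2.3650$ is the unique root of the equation $$\tan(z)+\tanh(z)=0$$ in the interval $(0,\pi)$.
   Context: For a bounded connected Lipschitz domain $\Omega\subset\mathbb{R}^d$ and a measurable part $\Gamma\subset\partial\Omega$ of positive $(d-1)$-dimensional measure, let $\widetilde H^1(\Omega,\Gamma)=\{w\in H^1(\Omega): \text{the mean value of (the trace of) } w \text{ on } \Gamma \text{ is zero}\}$. The norm in $L^2(\omega)$ is denoted $\|\cdot\|_{2,\omega}$. The sharp constant $C_2(\Omega,\Gamma)$ is the smallest constant $C$ such that $\|w\|_{2,\Gamma}\le C\|\nabla w\|_{2,\Omega}$ for all $w\in\widetilde H^1(\Omega,\Gamma)$. *)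

theory Defs
  imports "HOL-Analysis.Analysis"
begin

section \<open>Surface measure\<close>

text \<open>
  \<open>k\<close>-dimensional Hausdorff outer measure, with the normalisation that makes it agree with
  Lebesgue measure on \<open>k\<close>-dimensional planes. Covering sets are required to be bounded because
  \<^const>\<open>diameter\<close> is only meaningful for bounded sets; the empty set has weight \<open>0\<close> also
  for \<open>k = 0\<close>.
\<close>

definition hausdorff_weight :: "nat \<Rightarrow> 'a::euclidean_space set \<Rightarrow> ennreal" where
  "hausdorff_weight k U =
     (if U = {} then 0 else ennreal (unit_ball_vol (real k) * (diameter U / 2) ^ k))"

definition hausdorff_pre :: "nat \<Rightarrow> real \<Rightarrow> 'a::euclidean_space set \<Rightarrow> ennreal" where
  "hausdorff_pre k \<delta> A =
     Inf {(\<Sum>i. hausdorff_weight k (U i)) | U :: nat \<Rightarrow> 'a set.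
            A \<subseteq> (\<Union>i. U i) \<and> (\<forall>i. bounded (U i) \<and> diameter (U i) \<le> \<delta>)}"

definition hausdorff_outer :: "nat \<Rightarrow> 'a::euclidean_space set \<Rightarrow> ennreal" where
  "hausdorff_outer k A = (SUP \<delta>\<in>{0<..}. hausdorff_pre k \<delta> A)"

text \<open>\<open>(d - 1)\<close>-dimensional measure on the (relatively) Borel subsets of \<open>\<Gamma>\<close>.\<close>

definition surface_measure :: "'a::euclidean_space set \<Rightarrow> 'a measure" where
  "surface_measure \<Gamma> =
     measure_of \<Gamma> (sets (restrict_space borel \<Gamma>)) (hausdorff_outer (DIM('a) - 1))"


section \<open>Square-integrable functions\<close>

definition L2 :: "'a measure \<Rightarrow> ('a \<Rightarrow> 'b::euclidean_space) set" where
  "L2 M = {f. f \<in> borel_measurable M \<and> integrable M (\<lambda>x. (norm (f x))\<^sup>2)}"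

definition L2_norm :: "'a measure \<Rightarrow> ('a \<Rightarrow> 'b::euclidean_space) \<Rightarrow> real" where
  "L2_norm M f = sqrt (integral\<^sup>L M (\<lambda>x. (norm (f x))\<^sup>2))"

definition L2_converges ::
  "'a measure \<Rightarrow> (nat \<Rightarrow> 'a \<Rightarrow> 'b::euclidean_space) \<Rightarrow> ('a \<Rightarrow> 'b) \<Rightarrow> bool" where
  "L2_converges M f g \<longleftrightarrow>
     (\<forall>n. f n \<in> L2 M) \<and> g \<in> L2 M \<and> (\<lambda>n. L2_norm M (\<lambda>x. f n x - g x)) \<longlonglongrightarrow> 0"


section \<open>Sobolev space and traces\<close>

definition partial_deriv :: "'a::euclidean_space \<Rightarrow> ('a \<Rightarrow> real) \<Rightarrow> 'a \<Rightarrow> real" where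
  "partial_deriv b f x = frechet_derivative f (at x) b"

definition grad :: "('a::euclidean_space \<Rightarrow> real) \<Rightarrow> 'a \<Rightarrow> 'a" where
  "grad f x = (\<Sum>b\<in>Basis. partial_deriv b f x *\<^sub>R b)"

primrec C_k :: "nat \<Rightarrow> ('a::euclidean_space \<Rightarrow> real) \<Rightarrow> bool" where
  "C_k 0 f \<longleftrightarrow> continuous_on UNIV f"
| "C_k (Suc k) f \<longleftrightarrow>
     (\<forall>x. f differentiable (at x)) \<and> (\<forall>b\<in>Basis. C_k k (partial_deriv b f))"

definition smooth :: "('a::euclidean_space \<Rightarrow> real) \<Rightarrow> bool" where
  "smooth f \<longleftrightarrow> (\<forall>k. C_k k f)"

definition test_function :: "'a::euclidean_space set \<Rightarrow> ('a \<Rightarrow> real) \<Rightarrow> bool" where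
  "test_function \<Omega> \<phi> \<longleftrightarrow>
     smooth \<phi> \<and> (\<exists>K. compact K \<and> K \<subseteq> \<Omega> \<and> (\<forall>x. x \<notin> K \<longrightarrow> \<phi> x = 0))"

definition weak_grad ::
  "'a::euclidean_space set \<Rightarrow> ('a \<Rightarrow> real) \<Rightarrow> ('a \<Rightarrow> 'a) \<Rightarrow> bool" where
  "weak_grad \<Omega> w G \<longleftrightarrow>
     w \<in> L2 (lebesgue_on \<Omega>) \<and> G \<in> L2 (lebesgue_on \<Omega>) \<and>
     (\<forall>\<phi>. test_function \<Omega> \<phi> \<longrightarrow> (\<forall>b\<in>Basis.
        integral\<^sup>L (lebesgue_on \<Omega>) (\<lambda>x. w x * partial_deriv b \<phi> x) =
        - integral\<^sup>L (lebesgue_on \<Omega>) (\<lambda>x. (G x \<bullet> b) * \<phi> x)))"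

definition H1 :: "'a::euclidean_space set \<Rightarrow> ('a \<Rightarrow> real) set" where
  "H1 \<Omega> = {w. \<exists>G. weak_grad \<Omega> w G}"

text \<open>
  The trace operator is the continuous extension to \<open>H\<^sup>1(\<Omega>)\<close> of the restriction map
  \<open>\<phi> \<mapsto> \<phi>|\<^sub>\<Gamma>\<close> on functions smooth up to the boundary; \<open>has_trace \<Omega> \<Gamma> w g\<close> is its graph.
  For a bounded Lipschitz domain every \<open>w \<in> H\<^sup>1(\<Omega>)\<close> has a trace, unique almost everywhere on
  \<open>\<Gamma>\<close>.
\<close>

definition has_trace ::
  "'a::euclidean_space set \<Rightarrow> 'a set \<Rightarrow> ('a \<Rightarrow> real) \<Rightarrow> ('a \<Rightarrow> real) \<Rightarrow> bool" where
  "has_trace \<Omega> \<Gamma> w g \<longleftrightarrow>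
     (\<exists>G \<phi>. weak_grad \<Omega> w G \<and> (\<forall>n. smooth (\<phi> n)) \<and>
        L2_converges (lebesgue_on \<Omega>) \<phi> w \<and>
        L2_converges (lebesgue_on \<Omega>) (\<lambda>n. grad (\<phi> n)) G \<and>
        L2_converges (surface_measure \<Gamma>) \<phi> g)"

definition mean :: "'a measure \<Rightarrow> ('a \<Rightarrow> real) \<Rightarrow> real" where
  "mean M g = integral\<^sup>L M g / measure M (space M)"

definition H1_tilde :: "'a::euclidean_space set \<Rightarrow> 'a set \<Rightarrow> ('a \<Rightarrow> real) set" where
  "H1_tilde \<Omega> \<Gamma> = {w \<in> H1 \<Omega>. \<exists>g. has_trace \<Omega> \<Gamma> w g \<and> mean (surface_measure \<Gamma>) g = 0}"


section \<open>The sharp constant\<close>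

definition trace_inequality :: "'a::euclidean_space set \<Rightarrow> 'a set \<Rightarrow> real \<Rightarrow> bool" where
  "trace_inequality \<Omega> \<Gamma> C \<longleftrightarrow>
     (\<forall>w\<in>H1_tilde \<Omega> \<Gamma>. \<forall>g G. has_trace \<Omega> \<Gamma> w g \<longrightarrow> weak_grad \<Omega> w G \<longrightarrow>
        L2_norm (surface_measure \<Gamma>) g \<le> C * L2_norm (lebesgue_on \<Omega>) G)"

definition is_sharp_C2 :: "'a::euclidean_space set \<Rightarrow> 'a set \<Rightarrow> real \<Rightarrow> bool" where
  "is_sharp_C2 \<Omega> \<Gamma> C \<longleftrightarrow>
     trace_inequality \<Omega> \<Gamma> C \<and> (\<forall>C'. trace_inequality \<Omega> \<Gamma> C' \<longrightarrow> C \<le> C')"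

end

theory Submission
  imports Defs
begin

text \<open>
Put \<open>k = z\<^sub>0 / h\<close> and \<open>u x = cosh (k x\<^sub>1) cos (k x\<^sub>2) + cos (k x\<^sub>1) cosh (k x\<^sub>2)\<close>. This function is
harmonic. It is even in \<open>x\<^sub>2\<close> and symmetric in the two coordinates, so its normal derivative vanishes on
the leg \<open>x\<^sub>2 = 0\<close> and on the hypotenuse. On the leg \<open>x\<^sub>1 = h\<close> the normal derivative equals
\<open>(z\<^sub>0 / h) tanh z\<^sub>0\<close> times \<open>u\<close>, exactly because \<open>tan z\<^sub>0 + tanh z\<^sub>0 = 0\<close>, and the same equation makes the
trace of \<open>u\<close> mean-free. Hence \<open>u\<close> is a Steklov eigenfunction, and Green's formula shows that the constant
cannot be smaller than the claimed one (\<open>trace_inequality_lower_bound\<close>).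

The substance is that \<open>(z\<^sub>0 / h) tanh z\<^sub>0\<close> is the least positive Steklov eigenvalue. Replacing \<open>k\<close> in \<open>u\<close>
by \<open>\<nu>\<^sub>n = n \<pi> / h\<close> gives a harmonic function with normal derivative proportional to \<open>cos (\<nu>\<^sub>n y)\<close> on the leg
and zero on the other two sides. So the Neumann-to-Dirichlet form is known explicitly in the basis of these
cosines: up to the factor \<open>h / 2\<close> its matrix is
\<open>\<delta>\<^sub>m\<^sub>n coth (n \<pi>) / \<nu>\<^sub>n + (2 / h) (- 1)\<^sup>m\<^sup>+\<^sup>n / (\<nu>\<^sub>m\<^sup>2 + \<nu>\<^sub>n\<^sup>2)\<close>.
After the sign change \<open>(- 1)\<^sup>n\<close> of the basis all entries are nonnegative. The trace of \<open>u\<close> is an eigenvector,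
and with the same sign change its coefficients are proportional to \<open>\<nu>\<^sub>n\<^sup>2 / (\<nu>\<^sub>n\<^sup>4 - k\<^sup>4)\<close>. They are positive
since \<open>k < \<nu>\<^sub>1\<close>, that is, since \<open>z\<^sub>0 < \<pi>\<close>. A nonnegative symmetric matrix with a positive eigenvector is
bounded by the eigenvalue; this is the Schur test (\<open>schur_bound\<close>). Its row sums are evaluated by Parseval's
identity for the trace of \<open>u\<close> against \<open>cosh (\<nu>\<^sub>m y)\<close> (\<open>perron_row_sum\<close>).

For smooth \<open>\<phi>\<close>, comparing \<open>\<nabla>\<phi>\<close> with the gradient of the harmonic function whose Neumann data on the leg
is a partial cosine sum of the trace of \<open>\<phi>\<close> gives the trace inequality for that partial sum, and Parseval's
identity gives it for \<open>\<phi>\<close> (\<open>smooth_trace_inequality\<close>). It extends to traces of Sobolev functions by \<open>L\<^sup>2\<close> limits.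
Two points need care there: the weak gradient is unique almost everywhere (\<open>weak_grad_unique\<close>), and the mean
of a trace depends only on the function, because the divergence theorem for the field \<open>\<psi> x\<close>
writes it as an integral over the triangle (\<open>green_position\<close>).
\<close>

section \<open>The frequency equation\<close>

text \<open>
The frequency equation multiplied by \<open>cos z cosh z\<close>. Unlike the sum of tangents it is entire, and it is
monotone where its root lies.
\<close>

definition freq_fun :: "real \<Rightarrow> real" where
  "freq_fun z = sin z * cosh z + cos z * sinh z"

lemma freq_fun_deriv: "(freq_fun has_real_derivative 2 * cos z * cosh z) (at z)"
  unfolding freq_fun_def[abs_def]
  by (auto intro!: derivative_eq_intros simp: algebra_simps)

text \<open>
The iterated derivatives of \<open>freq_fun\<close>: its fourth derivative is \<open>- 4 * freq_fun\<close>, so they are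
periodic up to powers of \<open>- 4\<close>.
\<close>

definition freq_fun_derivs :: "nat \<Rightarrow> real \<Rightarrow> real" where
  "freq_fun_derivs m z = (-4) ^ (m div 4) *
     (if m mod 4 = 0 then freq_fun z
      else if m mod 4 = 1 then 2 * cos z * cosh z
      else if m mod 4 = 2 then 2 * (cos z * sinh z - sin z * cosh z)
      else - 4 * sin z * sinh z)"

lemma freq_fun_derivs_Suc:
  "(freq_fun_derivs m has_real_derivative freq_fun_derivs (Suc m) z) (at z)"
proof -
  define j where "j = m div 4"
  have "m mod 4 = 0 \<or> m mod 4 = 1 \<or> m mod 4 = 2 \<or> m mod 4 = 3" by presburger
  then have "m = 4 * j \<or> m = 4 * j + 1 \<or> m = 4 * j + 2 \<or> m = 4 * j + 3"
    unfolding j_def by presburger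
  then consider "m = 4 * j" | "m = 4 * j + 1" | "m = 4 * j + 2" | "m = 4 * j + 3" by blast
  then show ?thesis
  proof cases
    case 1
    have d: "Suc m div 4 = j" "Suc m mod 4 = 1" "m div 4 = j" "m mod 4 = 0" using 1 by presburger+
    show ?thesis unfolding freq_fun_derivs_def[abs_def] d
      by (auto intro!: derivative_eq_intros freq_fun_deriv simp: algebra_simps)
  next
    case 2
    have d: "Suc m div 4 = j" "Suc m mod 4 = 2" "m div 4 = j" "m mod 4 = 1" using 2 by presburger+
    show ?thesis unfolding freq_fun_derivs_def[abs_def] d
      by (auto intro!: derivative_eq_intros simp: algebra_simps)
  next
    case 3
    have d: "Suc m div 4 = j" "Suc m mod 4 = 3" "m div 4 = j" "m mod 4 = 2" using 3 by presburger+
    show ?thesis unfolding freq_fun_derivs_def[abs_def] d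
      by (auto intro!: derivative_eq_intros simp: algebra_simps)
  next
    case 4
    have d: "Suc m div 4 = Suc j" "Suc m mod 4 = 0" "m div 4 = j" "m mod 4 = 3" using 4 by presburger+
    show ?thesis unfolding freq_fun_derivs_def[abs_def] d freq_fun_def
      by (auto intro!: derivative_eq_intros simp: algebra_simps)
  qed
qed

lemma exp_3_le: "exp (3::real) \<le> 27"
proof -
  have "exp (3::real) = exp 1 ^ 3" by (simp flip: exp_of_nat_mult)
  also have "\<dots> \<le> 3 ^ 3" by (rule power_mono) (use exp_le in auto)
  finally show ?thesis by simp
qed

lemma abs_freq_fun_le:
  assumes "\<bar>t\<bar> \<le> 3" shows "\<bar>freq_fun t\<bar> \<le> 54"
proof -
  have e: "exp t \<le> 27" "exp (-t) \<le> 27"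
    using assms by (intro order_trans[OF _ exp_3_le]; simp)+
  have "\<bar>(p + q) / 2\<bar> \<le> 27 \<and> \<bar>(p - q) / 2\<bar> \<le> 27"
    if "0 < p" "0 < q" "p \<le> 27" "q \<le> 27" for p q :: real
    using that by (simp add: abs_le_iff)
  then have c: "\<bar>cosh t\<bar> \<le> 27" "\<bar>sinh t\<bar> \<le> 27"
    using e exp_gt_zero[of t] exp_gt_zero[of "-t"] unfolding cosh_field_def sinh_field_def by blast+
  have "\<bar>sin t * cosh t\<bar> \<le> 1 * 27" unfolding abs_mult by (rule mult_mono) (use c in auto)
  moreover have "\<bar>cos t * sinh t\<bar> \<le> 1 * 27" unfolding abs_mult by (rule mult_mono) (use c in auto)
  ultimately show ?thesis unfolding freq_fun_def by linarith
qed

text \<open>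
At \<open>0\<close> only every fourth derivative, starting with the first, is nonzero, so five terms reach order 19.
\<close>

lemma freq_fun_taylor:
  assumes "0 \<le> z" "z \<le> 3"
  shows "\<bar>freq_fun z - 2 * (z - 4 * z ^ 5 / 120 + 16 * z ^ 9 / 362880 - 64 * z ^ 13 / 6227020800
           + 256 * z ^ 17 / 355687428096000)\<bar> \<le> 55296 * z ^ 20 / 2432902008176640000"
proof -
  have f0: "freq_fun_derivs 0 = freq_fun" by (simp add: freq_fun_derivs_def fun_eq_iff)
  obtain t where t: "\<bar>t\<bar> \<le> \<bar>z\<bar>" and
    eq: "freq_fun z = (\<Sum>m<20. (freq_fun_derivs m 0 / fact m) * z ^ m) + (freq_fun_derivs 20 t / fact 20) * z ^ 20"
    using Maclaurin_all_le[where f = freq_fun and diff = freq_fun_derivs and x = z and n = 20] f0 freq_fun_derivs_Suc by blast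
  have s: "(\<Sum>m<20. (freq_fun_derivs m 0 / fact m) * z ^ m)
     = 2 * (z - 4 * z ^ 5 / 120 + 16 * z ^ 9 / 362880 - 64 * z ^ 13 / 6227020800
           + 256 * z ^ 17 / 355687428096000)"
    by (simp add: lessThan_nat_numeral freq_fun_derivs_def freq_fun_def fact_numeral)
  \<comment> \<open>The constant is \<open>4 ^ 5 * 54\<close>.\<close>
  have "\<bar>freq_fun_derivs 20 t\<bar> \<le> 55296"
    using abs_freq_fun_le[of t] t assms by (simp add: freq_fun_derivs_def abs_mult)
  then have "\<bar>(freq_fun_derivs 20 t / fact 20) * z ^ 20\<bar> \<le> 55296 / fact 20 * z ^ 20"
    using assms by (simp add: abs_mult divide_right_mono mult_right_mono)
  moreover have "(fact 20 :: real) = 2432902008176640000" by (simp add: fact_numeral)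
  ultimately show ?thesis unfolding eq s by simp
qed

lemma abs_diff_le_sign:
  fixes f p e :: real
  assumes "\<bar>f - p\<bar> \<le> e" shows "e < p \<Longrightarrow> 0 < f" "p < - e \<Longrightarrow> f < 0"
  using assms by linarith+

lemma freq_fun_signs: "freq_fun (2.36495) > 0" "freq_fun (2.36505) < 0"
proof -
  have "2 * (z - 4 * z ^ 5 / 120 + 16 * z ^ 9 / 362880 - 64 * z ^ 13 / 6227020800
       + 256 * z ^ 17 / 355687428096000) > 55296 * z ^ 20 / 2432902008176640000"
    if "z = 47299 / 20000" for z :: real
    unfolding that power_divide by simp
  from this[of "2.36495"] show "freq_fun (2.36495) > 0"
    by (intro abs_diff_le_sign(1)[OF freq_fun_taylor]) simp_all
  have "2 * (z - 4 * z ^ 5 / 120 + 16 * z ^ 9 / 362880 - 64 * z ^ 13 / 6227020800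
       + 256 * z ^ 17 / 355687428096000) < - (55296 * z ^ 20 / 2432902008176640000)"
    if "z = 47301 / 20000" for z :: real
    unfolding that power_divide by simp
  from this[of "2.36505"] show "freq_fun (2.36505) < 0"
    by (intro abs_diff_le_sign(2)[OF freq_fun_taylor]) simp_all
qed

text \<open>
At \<open>z = pi / 2\<close> the convention \<open>x / 0 = 0\<close> makes \<open>tan z = 0\<close>; neither side has a root there.
\<close>

lemma root_iff_freq_fun:
  assumes "0 < z" "z < pi"
  shows "tan z + tanh z = 0 \<longleftrightarrow> freq_fun z = 0"
proof (cases "cos z = 0")
  case True
  have "sin z > 0" using assms sin_gt_zero by blast
  with True assms show ?thesis by (simp add: tan_def freq_fun_def)
next
  case False
  have "freq_fun z = (tan z + tanh z) * (cos z * cosh z)"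
    using False by (simp add: freq_fun_def tan_def tanh_def field_simps)
  with False show ?thesis by simp
qed

lemma freq_fun_pos:
  assumes "0 < z" "z \<le> pi / 2" shows "freq_fun z > 0"
proof -
  have "sin z > 0" "cos z \<ge> 0" "sinh z > 0"
    using assms by (auto intro: sin_gt_zero cos_ge_zero)
  then show ?thesis unfolding freq_fun_def by (intro add_pos_nonneg mult_pos_pos mult_nonneg_nonneg) auto
qed

lemma freq_fun_decreasing:
  assumes "pi / 2 \<le> x" "x < y" "y \<le> pi" shows "freq_fun y < freq_fun x"
proof (rule DERIV_neg_imp_decreasing_open[OF \<open>x < y\<close>])
  fix t assume t: "x < t" "t < y"
  have "cos t < 0" using cos_gt_zero_pi[of "pi - t"] t assms by (auto simp: cos_diff)
  then have "2 * cos t * cosh t < 0" using mult_neg_pos[of "2 * cos t" "cosh t"] by simp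
  then show "\<exists>D. (freq_fun has_real_derivative D) (at t) \<and> D < 0" using freq_fun_deriv by blast
next
  show "continuous_on {x..y} freq_fun"
    unfolding freq_fun_def[abs_def] by (intro continuous_intros)
qed

text \<open>
There is no root up to \<open>pi / 2\<close>, where both summands of \<open>freq_fun\<close> are nonnegative and the first is positive;
beyond it \<open>freq_fun\<close> is strictly
decreasing; the sign change between the two decimals locates the root.
\<close>

lemma frequency_exists:
  obtains z0 :: real where "{z. 0 < z \<and> z < pi \<and> tan z + tanh z = 0} = {z0}"
    "\<bar>z0 - 2.3650\<bar> \<le> 0.00005" "pi / 2 < z0" "z0 < pi"
    "sin z0 * cosh z0 + cos z0 * sinh z0 = 0"
proof -
  have "continuous_on {2.36495..2.36505} freq_fun"
    unfolding freq_fun_def[abs_def] by (intro continuous_intros)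
  then obtain z0 where z0: "2.36495 \<le> z0" "z0 \<le> 2.36505" "freq_fun z0 = 0"
    using IVT2'[of freq_fun "2.36505" 0 "2.36495"] freq_fun_signs by auto
  have "2 < z0" "z0 < 3" using z0 by (simp_all add: field_simps)
  then have pb: "pi / 2 < z0" "z0 < pi" using pi_gt3 pi_less_4 by linarith+
  have "z = z0" if "0 < z" "z < pi" "tan z + tanh z = 0" for z
  proof -
    have f: "freq_fun z = 0" using that root_iff_freq_fun by blast
    then have "pi / 2 < z" using freq_fun_pos[of z] that by force
    then show ?thesis using freq_fun_decreasing[of z z0] freq_fun_decreasing[of z0 z] f z0(3) pb that
      by (cases z z0 rule: linorder_cases) auto
  qed
  moreover have "tan z0 + tanh z0 = 0" "0 < z0" using root_iff_freq_fun[of z0] pb z0 pi_gt_zero by auto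
  ultimately have "{z. 0 < z \<and> z < pi \<and> tan z + tanh z = 0} = {z0}" using pb by blast
  moreover have "\<bar>z0 - 2.3650\<bar> \<le> 0.00005" using z0 unfolding abs_le_iff by (simp add: field_simps)
  ultimately show ?thesis using that pb z0 by (simp add: freq_fun_def)
qed

section \<open>Hausdorff measure on the leg\<close>

lemma hausdorff_weight_1:
  "bounded (U::'a::euclidean_space set) \<Longrightarrow> hausdorff_weight 1 U = ennreal (diameter U)"
  by (auto simp: hausdorff_weight_def unit_ball_vol_1)

lemma real_bounded_subset_interval:
  fixes S :: "real set"
  assumes "bounded S" "S \<noteq> {}"
  obtains a where "S \<subseteq> {a..a + diameter S}"
proof
  show "S \<subseteq> {Inf S..Inf S + diameter S}"
  proof
    fix y assume y: "y \<in> S"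
    have "y - diameter S \<le> Inf S"
    proof (rule cInf_greatest[OF assms(2)])
      fix x assume "x \<in> S"
      then show "y - diameter S \<le> x"
        using diameter_bounded_bound[OF assms(1) y, of x] by (auto simp: dist_real_def)
    qed
    moreover have "Inf S \<le> y" using y assms by (auto intro: cInf_lower bounded_imp_bdd_below)
    ultimately show "y \<in> {Inf S..Inf S + diameter S}" by simp
  qed
qed

definition leg_map :: "real \<Rightarrow> real \<Rightarrow> real^2" where
  "leg_map h y = vector [h, y]"

lemma leg_map_nth [simp]: "leg_map h y $ 1 = h" "leg_map h y $ 2 = y"
  by (simp_all add: leg_map_def)

lemma dist_leg_map [simp]: "dist (leg_map h x) (leg_map h y) = dist x y"
  by (simp add: dist_norm norm_vec_def L2_set_def sum_2 UNIV_2)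

lemma continuous_on_leg_map [continuous_intros]: "continuous_on S (leg_map h)"
  unfolding continuous_on_iff dist_leg_map by blast

lemma bounded_leg_image: "bounded S \<Longrightarrow> bounded (leg_map h ` S)"
  by (meson bounded_closure bounded_subset closure_subset compact_continuous_image compact_eq_bounded_closed
      compact_closure continuous_on_leg_map compact_imp_bounded image_mono)

lemma diameter_leg_image: "diameter (leg_map h ` S) = diameter S"
proof -
  have "(\<lambda>(x, y). dist x y) ` (leg_map h ` S \<times> leg_map h ` S) = (\<lambda>(x, y). dist x y) ` (S \<times> S)"
    by (force simp: image_iff)
  then show ?thesis by (simp add: diameter_def)
qed

lemma diameter_Icc: "a \<le> b \<Longrightarrow> diameter {a..b::real} = b - a"
  using diameter_cbox[of a b] by (simp add: cbox_interval dist_real_def diameter_def) 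

text \<open>
The second coordinates of a covering set lie in an interval no longer than its diameter, so any cover of
the image gives a cover of \<open>A\<close> by intervals of no larger total length.
\<close>

lemma emeasure_le_hausdorff_pre:
  assumes A: "A \<in> sets borel"
  shows "emeasure lborel A \<le> hausdorff_pre 1 \<delta> (leg_map h ` A)"
  unfolding hausdorff_pre_def
proof (rule Inf_greatest, clarify)
  fix U :: "nat \<Rightarrow> (real^2) set"
  assume cov: "leg_map h ` A \<subseteq> (\<Union>i. U i)" and U: "\<forall>i. bounded (U i) \<and> diameter (U i) \<le> \<delta>"
  define V where "V i = leg_map h -` U i" for i
  have sub: "leg_map h ` V i \<subseteq> U i" for i by (auto simp: V_def)
  have "\<exists>a. V i \<subseteq> {a..a + diameter (U i)}" for i
  proof (cases "V i = {}")
    case False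
    have "bounded ((\<lambda>x. x $ 2) ` U i)"
      using U by (intro bounded_linear_image bounded_linear_vec_nth) auto
    moreover have "V i \<subseteq> (\<lambda>x. x $ 2) ` U i" by (force simp: V_def image_iff)
    ultimately have b: "bounded (V i)" by (rule bounded_subset)
    then obtain a where "V i \<subseteq> {a..a + diameter (V i)}"
      using real_bounded_subset_interval[OF b False] by blast
    moreover have "diameter (V i) \<le> diameter (U i)"
      using diameter_subset[OF sub[of i]] U by (simp add: diameter_leg_image)
    ultimately show ?thesis by force
  qed auto
  then have "\<exists>a. \<forall>i. V i \<subseteq> {a i..a i + diameter (U i)}" by (intro choice) blast
  then obtain a where a: "\<And>i. V i \<subseteq> {a i..a i + diameter (U i)}" by blast
  have "A \<subseteq> (\<Union>i. V i)" using cov by (fastforce simp: V_def)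
  then have "A \<subseteq> (\<Union>i. {a i..a i + diameter (U i)})" using a by blast
  then have "emeasure lborel A \<le> emeasure lborel (\<Union>i. {a i..a i + diameter (U i)})"
    by (intro emeasure_mono) auto
  also have "\<dots> \<le> (\<Sum>i. emeasure lborel {a i..a i + diameter (U i)})"
    by (rule emeasure_subadditive_countably) auto
  also have "\<dots> = (\<Sum>i. hausdorff_weight 1 (U i))"
    using U by (intro suminf_cong) (simp add: hausdorff_weight_1[unfolded One_nat_def] diameter_ge_0)
  finally show "emeasure lborel A \<le> (\<Sum>i. hausdorff_weight 1 (U i))" .
qed

lemma interval_cover:
  fixes c d :: real and n :: nat
  assumes n: "n > 0" and y: "y \<in> {c..d}"
  shows "\<exists>j<n. y \<in> {c + (d - c) * real j / n..c + (d - c) * (real j + 1) / n}"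
proof (cases "y = d \<or> c = d")
  case True
  have "y = d" using True y by auto
  then show ?thesis using n y
    by (intro exI[of _ "n - 1"]) (auto simp: field_simps of_nat_diff)
next
  case False
  then have cd: "c < d" "c \<le> y" "y < d" using y by auto
  define t where "t = (y - c) / (d - c) * n"
  have t: "0 \<le> t" "t < n" using cd n by (auto simp: t_def field_simps)
  define j where "j = nat \<lfloor>t\<rfloor>"
  have j: "real j \<le> t" "t < real j + 1" using t by (auto simp: j_def)
  have jn: "j < n" using j t by simp
  have y: "y = c + (d - c) * t / n" using cd n by (simp add: t_def)
  have "(d - c) * real j / n \<le> (d - c) * t / n" "(d - c) * t / n \<le> (d - c) * (real j + 1) / n"
    using j cd n by (intro divide_right_mono mult_left_mono; simp)+
  then show ?thesis using jn unfolding y by auto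
qed

text \<open>
Cover \<open>A\<close> by non-overlapping intervals of total length at most \<open>e\<close> more than its measure, and cut each
into \<open>n\<close> equal pieces shorter than \<open>\<delta>\<close>: this does not change the total length.
\<close>

lemma hausdorff_pre_le_emeasure:
  assumes A: "A \<in> sets borel" "A \<subseteq> {0..h}" and h: "0 < h" and \<delta>: "0 < \<delta>" and e: "0 < e"
  shows "hausdorff_pre 1 \<delta> (leg_map h ` A) \<le> emeasure lborel A + ennreal e"
proof -
  have Am: "A \<in> lmeasurable"
    using A bounded_set_imp_lmeasurable[of A] bounded_subset[of "{0..h}" A] by auto
  obtain D where D: "countable D"
      "\<And>K. K \<in> D \<Longrightarrow> K \<subseteq> cbox 0 h \<and> K \<noteq> {} \<and> (\<exists>c d. K = cbox c d)"
      "pairwise (\<lambda>A B. interior A \<inter> interior B = {}) D"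
      "A \<subseteq> \<Union>D" "\<Union>D \<in> lmeasurable" "measure lebesgue (\<Union>D) \<le> measure lebesgue A + e"
  proof (rule measurable_outer_intervals_bounded[OF Am _ e, of 0 h], goal_cases)
    case 1
    show ?case using A by simp
  next
    case (2 D)
    show ?case by (rule 2(1)[OF 2(2) 2(3) 2(4) 2(7) 2(8) 2(9)])
  qed
  \<comment> \<open>An enumeration of the intervals without repetitions, padded with empty sets of weight zero.\<close>
  define K where "K i = (if i \<in> to_nat_on D ` D then from_nat_into D i else {})" for i
  have KD: "K i = {} \<or> K i \<in> D" for i using D(1) by (auto simp: K_def)
  have UK: "(\<Union>i. K i) = \<Union>D"
  proof
    show "(\<Union>i. K i) \<subseteq> \<Union>D" using KD by blast
    show "\<Union>D \<subseteq> (\<Union>i. K i)"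
    proof clarify
      fix x X assume x: "x \<in> X" "X \<in> D"
      then have "K (to_nat_on D X) = X" using D(1) by (simp add: K_def)
      then show "x \<in> (\<Union>i. K i)" using x by blast
    qed
  qed
  have "\<exists>c d. K i = {c..d} \<and> (K i \<noteq> {} \<longrightarrow> 0 \<le> c \<and> c \<le> d \<and> d \<le> h)" for i
  proof (cases "K i = {}")
    case True
    then show ?thesis by (intro exI[of _ 1] exI[of _ 0]) auto
  next
    case False
    then obtain c d where "K i = {c..d}" "K i \<subseteq> {0..h}" using KD[of i] D(2)[of "K i"] by auto
    then show ?thesis using False by (intro exI[of _ c] exI[of _ d]) auto
  qed
  then obtain c d where cd: "\<And>i. K i = {c i..d i}"
      "\<And>i. K i \<noteq> {} \<Longrightarrow> 0 \<le> c i \<and> c i \<le> d i \<and> d i \<le> h" by metis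
  obtain n :: nat where n: "h / \<delta> < real n" using reals_Archimedean2 by blast
  have n0: "n > 0" using n h \<delta> by (metis divide_pos_pos gr0I less_asym of_nat_0)
  define U where "U i j = (if j < n \<and> K i \<noteq> {} then
      leg_map h ` {c i + (d i - c i) * real j / n..c i + (d i - c i) * (real j + 1) / n} else {})" for i j
  have dU: "diameter (U i j) = (d i - c i) / n" "bounded (U i j)" "U i j \<noteq> {}" if "j < n" "K i \<noteq> {}" for i j
  proof -
    have le: "c i + (d i - c i) * real j / n \<le> c i + (d i - c i) * (real j + 1) / n"
      using cd(2)[OF that(2)] by (intro add_left_mono divide_right_mono mult_left_mono) auto
    show "diameter (U i j) = (d i - c i) / n"
      using that le by (simp add: U_def diameter_leg_image diameter_Icc add_divide_distrib[symmetric] algebra_simps)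
    show "bounded (U i j)" using that by (simp add: U_def bounded_leg_image)
    show "U i j \<noteq> {}" using that le by (simp add: U_def)
  qed
  have w: "(\<Sum>j. hausdorff_weight 1 (U i j)) = emeasure lborel (K i)" for i
  proof (cases "K i = {}")
    case True
    then show ?thesis by (simp add: U_def hausdorff_weight_def)
  next
    case False
    have "(\<Sum>j. hausdorff_weight 1 (U i j)) = (\<Sum>j<n. hausdorff_weight 1 (U i j))"
      by (rule suminf_finite) (auto simp: U_def hausdorff_weight_def)
    also have "\<dots> = (\<Sum>j<n. ennreal ((d i - c i) / n))"
      using dU False by (intro sum.cong) (auto simp: hausdorff_weight_1[unfolded One_nat_def])
    also have "\<dots> = ennreal (d i - c i)"
      using n0 cd(2)[OF False] by (subst sum_ennreal) auto
    finally show ?thesis using cd[of i] False by simp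
  qed
  define W where "W p = (case prod_decode p of (i, j) \<Rightarrow> U i j)" for p
  have "hausdorff_pre 1 \<delta> (leg_map h ` A) \<le> (\<Sum>p. hausdorff_weight 1 (W p))"
    unfolding hausdorff_pre_def
  proof (rule Inf_lower, intro CollectI exI conjI)
    show "leg_map h ` A \<subseteq> (\<Union>i. W i)"
    proof clarify
      fix y assume "y \<in> A"
      then obtain i where i: "y \<in> K i" using D(4) UK by blast
      then have "y \<in> {c i..d i}" using cd by blast
      then obtain j where j: "j < n" "y \<in> {c i + (d i - c i) * real j / n..c i + (d i - c i) * (real j + 1) / n}"
        using interval_cover[OF n0] by blast
      have "K i \<noteq> {}" using i by blast
      then have "leg_map h y \<in> U i j" using j unfolding U_def by auto
      then have "leg_map h y \<in> W (prod_encode (i, j))" by (simp add: W_def)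
      then show "leg_map h y \<in> (\<Union>i. W i)" by blast
    qed
    show "\<forall>p. bounded (W p) \<and> diameter (W p) \<le> \<delta>"
    proof
      fix p
      obtain i j where p: "prod_decode p = (i, j)" by fastforce
      show "bounded (W p) \<and> diameter (W p) \<le> \<delta>"
      proof (cases "j < n \<and> K i \<noteq> {}")
        case True
        have "(d i - c i) / n \<le> h / n" using cd(2)[of i] True by (intro divide_right_mono) auto
        also have "\<dots> \<le> \<delta>" using n n0 \<delta> by (simp add: field_simps)
        finally show ?thesis using dU[of j i] True p by (simp add: W_def)
      next
        case False
        then have "U i j = {}" unfolding U_def by auto
        then show ?thesis using \<delta> p by (simp add: W_def)
      qed
    qed
  qed simp
  also have "\<dots> = (\<Sum>i. \<Sum>j. hausdorff_weight 1 (U i j))"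
    using suminf_ennreal_2dimen[of "\<lambda>i. \<Sum>j. hausdorff_weight 1 (U i j)" "\<lambda>(i, j). hausdorff_weight 1 (U i j)"]
    by (simp add: W_def case_prod_beta)
  also have "\<dots> = (\<Sum>i. emeasure lborel (interior (K i)))"
  proof (intro suminf_cong)
    fix i show "(\<Sum>j. hausdorff_weight 1 (U i j)) = emeasure lborel (interior (K i))"
      unfolding w cd(1) by (cases "c i \<le> d i") (auto simp: interior_atLeastAtMost_real)
  qed
  also have "\<dots> = emeasure lborel (\<Union>i. interior (K i))"
  proof (rule suminf_emeasure)
    show "disjoint_family (\<lambda>i. interior (K i))"
      unfolding disjoint_family_on_def
    proof clarsimp
      fix i j :: nat assume ij: "i \<noteq> j"
      show "interior (K i) \<inter> interior (K j) = {}"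
      proof (cases "K i = {} \<or> K j = {}")
        case False
        then have "i \<in> to_nat_on D ` D" "j \<in> to_nat_on D ` D" unfolding K_def by metis+
        then have "K i \<noteq> K j" using ij D(1) unfolding K_def by auto
        then show ?thesis using D(3) KD[of i] KD[of j] False unfolding pairwise_def by blast
      qed auto
    qed
  qed auto
  also have "\<dots> \<le> emeasure lebesgue (\<Union>D)"
  proof -
    have "emeasure lborel (\<Union>i. interior (K i)) = emeasure lebesgue (\<Union>i. interior (K i))"
      by (simp add: open_Union)
    also have "\<dots> \<le> emeasure lebesgue (\<Union>D)"
      using D(5) UK interior_subset by (intro emeasure_mono) (blast, auto)
    finally show ?thesis .
  qed
  also have "\<dots> = ennreal (measure lebesgue (\<Union>D))" using D(5) by (simp add: emeasure_eq_measure2 fmeasurableD2)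
  also have "\<dots> \<le> ennreal (measure lebesgue A + e)" using D(6) by (rule ennreal_leI)
  also have "\<dots> = ennreal (measure lebesgue A) + ennreal e" using e by (intro ennreal_plus) auto
  also have "ennreal (measure lebesgue A) = emeasure lborel A"
  proof -
    have "ennreal (measure lebesgue A) = emeasure lebesgue A"
      using Am by (simp add: emeasure_eq_measure2 fmeasurableD2)
    also have "\<dots> = emeasure lborel A" using A emeasure_completion[of A lborel] by simp
    finally show ?thesis .
  qed
  finally show ?thesis .
qed

lemma hausdorff_outer_leg:
  assumes A: "A \<in> sets borel" "A \<subseteq> {0..h}" and h: "0 < h"
  shows "hausdorff_outer 1 (leg_map h ` A) = emeasure lborel A"
  unfolding hausdorff_outer_def
proof (rule antisym)
  show "(SUP \<delta>\<in>{0<..}. hausdorff_pre 1 \<delta> (leg_map h ` A)) \<le> emeasure lborel A"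
  proof (rule SUP_least)
    fix \<delta> :: real assume "\<delta> \<in> {0<..}"
    then have \<delta>: "0 < \<delta>" by simp
    show "hausdorff_pre 1 \<delta> (leg_map h ` A) \<le> emeasure lborel A"
    proof (rule ennreal_le_epsilon)
      fix e :: real assume "0 < e"
      with \<delta> show "hausdorff_pre 1 \<delta> (leg_map h ` A) \<le> emeasure lborel A + ennreal e"
        by (rule hausdorff_pre_le_emeasure[OF A h])
    qed
  qed
  show "emeasure lborel A \<le> (SUP \<delta>\<in>{0<..}. hausdorff_pre 1 \<delta> (leg_map h ` A))"
    by (rule SUP_upper2[of 1]) (simp, rule emeasure_le_hausdorff_pre[OF A(1)])
qed

definition leg :: "real \<Rightarrow> (real^2) set" where
  "leg h = {x. x $ 1 = h \<and> 0 \<le> x $ 2 \<and> x $ 2 \<le> h}"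

lemma leg_eq_image: "leg h = leg_map h ` {0..h}"
proof -
  have "x \<in> leg_map h ` {0..h}" if "x \<in> leg h" for x
  proof (rule image_eqI)
    show "x = leg_map h (x $ 2)" using that by (simp add: vec_eq_iff forall_2 leg_def)
  qed (use that in \<open>simp add: leg_def\<close>)
  then show ?thesis by (auto simp: leg_def)
qed

lemma leg_map_borel [measurable]: "leg_map h \<in> borel \<rightarrow>\<^sub>M borel"
  by (rule borel_measurable_continuous_onI[OF continuous_on_leg_map])

lemma closed_leg: "closed (leg h)"
  unfolding leg_eq_image
  by (rule compact_imp_closed, rule compact_continuous_image[OF continuous_on_leg_map]) simp

text \<open>
On Borel sets the Hausdorff outer measure agrees with a genuine measure, so \<open>measure_of\<close> returns that
measure rather than the null measure.
\<close>

lemma surface_measure_leg: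
  assumes h: "0 < h"
  shows "surface_measure (leg h) =
    distr (restrict_space lborel {0..h}) (restrict_space borel (leg h)) (leg_map h)"
proof -
  let ?D = "distr (restrict_space lborel {0..h}) (restrict_space borel (leg h)) (leg_map h)"
  have m: "leg_map h \<in> restrict_space lborel {0..h} \<rightarrow>\<^sub>M restrict_space borel (leg h)"
    by (rule measurable_restrict_space3) (auto simp: leg_eq_image)
  have "hausdorff_outer 1 B = emeasure ?D B" if B: "B \<in> sets (restrict_space borel (leg h))" for B
  proof -
    have Bb: "B \<in> sets borel" "B \<subseteq> leg h"
      using B closed_leg[of h] by (auto simp: sets_restrict_space_iff)
    define A where "A = leg_map h -` B \<inter> {0..h}"
    have A: "A \<in> sets borel" "A \<subseteq> {0..h}"
      using measurable_sets_borel[OF leg_map_borel Bb(1)] by (auto simp: A_def)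
    have "B = leg_map h ` A" using Bb by (auto simp: A_def leg_eq_image)
    then have "hausdorff_outer 1 B = emeasure lborel A" using hausdorff_outer_leg[OF A h] by simp
    also have "\<dots> = emeasure ?D B"
      using m B A by (simp add: emeasure_distr emeasure_restrict_space space_restrict_space A_def Int_commute)
    finally show ?thesis .
  qed
  moreover have "sigma_sets (leg h) (sets (restrict_space borel (leg h))) = sets (restrict_space borel (leg h))"
    using sets.sigma_sets_eq[of "restrict_space borel (leg h)"] by (simp add: space_restrict_space)
  ultimately have "surface_measure (leg h) = measure_of (leg h) (sets (restrict_space borel (leg h))) (emeasure ?D)"
    unfolding surface_measure_def
    by (intro measure_of_eq) (simp_all add: sets.space_closed[of "restrict_space borel (leg h)", simplified space_restrict_space space_borel Int_UNIV_right])
  also have "\<dots> = ?D"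
    by (rule trans[OF _ measure_of_of_measure[of ?D]]) (simp only: space_distr sets_distr space_restrict_space2 space_restrict_space space_borel Int_UNIV_right)
  finally show ?thesis .
qed

lemma integral_surface_measure_leg:
  fixes f :: "real^2 \<Rightarrow> real"
  assumes h: "0 < h" and f: "continuous_on UNIV f"
  shows "integrable (surface_measure (leg h)) f"
    "integral\<^sup>L (surface_measure (leg h)) f = integral {0..h} (\<lambda>y. f (leg_map h y))"
proof -
  have m: "leg_map h \<in> restrict_space lborel {0..h} \<rightarrow>\<^sub>M restrict_space borel (leg h)"
    by (rule measurable_restrict_space3) (auto simp: leg_eq_image)
  have fm: "f \<in> borel_measurable (restrict_space borel (leg h))"
    using f by (intro measurable_restrict_space1 borel_measurable_continuous_onI)
  have c: "continuous_on {0..h} (\<lambda>y. f (leg_map h y))"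
    by (rule continuous_on_compose2[OF f]) (auto intro: continuous_on_leg_map)
  have si: "set_integrable lborel {0..h} (\<lambda>y. f (leg_map h y))"
    using borel_integrable_compact[OF _ c] by (simp add: set_integrable_def)
  have i: "integrable (restrict_space lborel {0..h}) (\<lambda>y. f (leg_map h y))"
    using si by (subst integrable_restrict_space) (auto simp: set_integrable_def)
  then show "integrable (surface_measure (leg h)) f"
    unfolding surface_measure_leg[OF h] by (subst integrable_distr_eq[OF m fm])
  have "integral\<^sup>L (surface_measure (leg h)) f = integral\<^sup>L (restrict_space lborel {0..h}) (\<lambda>y. f (leg_map h y))"
    unfolding surface_measure_leg[OF h] by (rule integral_distr[OF m fm])
  also have "\<dots> = (LINT y:{0..h}|lborel. f (leg_map h y))"
    by (subst integral_restrict_space) (auto simp: set_lebesgue_integral_def)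
  also have "\<dots> = integral {0..h} (\<lambda>y. f (leg_map h y))"
    by (rule set_borel_integral_eq_integral(2)[OF si])
  finally show "integral\<^sup>L (surface_measure (leg h)) f = integral {0..h} (\<lambda>y. f (leg_map h y))" .
qed

section \<open>Integration over the triangle\<close>

definition triangle :: "real \<Rightarrow> (real^2) set" where
  "triangle h = {x. 0 < x $ 2 \<and> x $ 2 < x $ 1 \<and> x $ 1 < h}"

lemma open_triangle: "open (triangle h)"
  unfolding triangle_def by (intro open_Collect_conj open_Collect_less continuous_intros)

lemma triangle_subset_cbox: "triangle h \<subseteq> cbox 0 (\<chi> i. h)"
  by (auto simp: triangle_def mem_box_cart forall_2)

lemma triangle_lebesgue [measurable]: "triangle h \<in> sets lebesgue" "triangle h \<in> sets borel"
  using open_triangle[of h] by (auto simp: borel_open)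

lemma integrable_triangle:
  fixes f :: "real^2 \<Rightarrow> 'b::euclidean_space"
  assumes "continuous_on UNIV f"
  shows "integrable (lebesgue_on (triangle h)) f"
proof -
  have "f absolutely_integrable_on cbox 0 (\<chi> i. h)"
    by (rule absolutely_integrable_continuous[OF continuous_on_subset[OF assms]]) simp
  then have "f absolutely_integrable_on triangle h"
    by (rule set_integrable_subset) (auto simp: triangle_subset_cbox)
  then show ?thesis by (simp add: integrable_restrict_space set_integrable_def)
qed

definition plane_map :: "real \<times> real \<Rightarrow> real^2" where
  "plane_map p = vector [fst p, snd p]"

lemma plane_map_nth [simp]: "plane_map p $ 1 = fst p" "plane_map p $ 2 = snd p"
  by (simp_all add: plane_map_def)

lemma continuous_on_vector_2 [continuous_intros]:
  assumes "continuous_on S f" "continuous_on S g"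
  shows "continuous_on S (\<lambda>x. vector [f x, g x] :: real^2)"
proof -
  have "continuous_on S (\<lambda>x. (\<chi> i. if i = 1 then f x else g x) :: real^2)"
  proof (rule continuous_on_vec_lambda)
    fix i :: 2 show "continuous_on S (\<lambda>x. if i = 1 then f x else g x)"
      using assms by (cases "i = 1") simp_all
  qed
  moreover have "(\<lambda>x. (\<chi> i. if i = 1 then f x else g x) :: real^2) = (\<lambda>x. vector [f x, g x])"
    by (auto simp: fun_eq_iff vec_eq_iff forall_2)
  ultimately show ?thesis by (simp only:)
qed

lemma continuous_plane_map: "continuous_on S plane_map"
  unfolding plane_map_def[abs_def] by (intro continuous_intros)

lemma plane_map_borel [measurable]: "plane_map \<in> borel \<rightarrow>\<^sub>M borel"
  by (rule borel_measurable_continuous_onI[OF continuous_plane_map])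

text \<open>
Fubini's theorem is stated for products; this transfers it to \<open>real ^ 2\<close>.
\<close>

lemma lborel_plane: "distr lborel borel plane_map = lborel"
proof (rule lborel_eqI[symmetric])
  fix l u :: "real^2" assume le: "\<And>b. b \<in> Basis \<Longrightarrow> l \<bullet> b \<le> u \<bullet> b"
  have le': "l $ 1 \<le> u $ 1" "l $ 2 \<le> u $ 2"
    using le[of "axis 1 1"] le[of "axis 2 1"] by (auto simp: inner_axis axis_in_Basis_iff)
  have "plane_map -` box l u = box (l $ 1) (u $ 1) \<times> box (l $ 2) (u $ 2)"
    by (auto simp: mem_box_cart forall_2)
  then have "emeasure (distr lborel borel plane_map) (box l u)
      = emeasure lborel (box (l $ 1) (u $ 1) \<times> box (l $ 2) (u $ 2))"
    by (subst emeasure_distr) auto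
  also have "\<dots> = ennreal ((u $ 1 - l $ 1) * (u $ 2 - l $ 2))"
    unfolding lborel_prod[symmetric]
    using le' by (subst lborel.emeasure_pair_measure_Times) (auto simp: ennreal_mult)
  also have "(u $ 1 - l $ 1) * (u $ 2 - l $ 2) = (\<Prod>b\<in>Basis. (u - l) \<bullet> b)"
    by (simp add: Basis_vec_def prod.UNION_disjoint UNIV_2 inner_axis axis_eq_axis)
  finally show "emeasure (distr lborel borel plane_map) (box l u) = (\<Prod>b\<in>Basis. (u - l) \<bullet> b)" .
qed simp

lemma integral_triangle_iterated:
  fixes F :: "real \<Rightarrow> real \<Rightarrow> real"
  assumes F: "continuous_on UNIV (\<lambda>v::real^2. F (v $ 1) (v $ 2))"
  shows "integral\<^sup>L (lebesgue_on (triangle h)) (\<lambda>v. F (v $ 1) (v $ 2)) =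
      (LINT y|lborel. LINT x|lborel. of_bool (0 < y \<and> y < x \<and> x < h) * F x y)"
    "integral\<^sup>L (lebesgue_on (triangle h)) (\<lambda>v. F (v $ 1) (v $ 2)) =
      (LINT x|lborel. LINT y|lborel. of_bool (0 < y \<and> y < x \<and> x < h) * F x y)"
proof -
  let ?G = "\<lambda>v::real^2. indicator (triangle h) v * F (v $ 1) (v $ 2)"
  have Fm[measurable]: "(\<lambda>v::real^2. F (v $ 1) (v $ 2)) \<in> borel_measurable borel"
    using F by (rule borel_measurable_continuous_onI)
  have Gm: "?G \<in> borel_measurable borel" by measurable
  have "integrable lebesgue ?G"
    using integrable_triangle[OF F, of h] by (simp add: integrable_restrict_space)
  then have Gi: "integrable lborel ?G" using Gm by (simp add: integrable_completion)
  let ?H = "\<lambda>(x, y). of_bool (0 < y \<and> y < x \<and> x < h) * F x y :: real"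
  have GH: "?G (plane_map p) = ?H p" for p by (cases p) (auto simp: triangle_def indicator_def)
  have "integrable (distr lborel borel plane_map) ?G" using Gi by (simp add: lborel_plane)
  then have "integrable lborel (\<lambda>p. ?G (plane_map p))"
    by (subst (asm) integrable_distr_eq) (use Gm in auto)
  then have Hi: "integrable (lborel \<Otimes>\<^sub>M lborel) ?H" unfolding GH lborel_prod .
  have "integral\<^sup>L (lebesgue_on (triangle h)) (\<lambda>v. F (v $ 1) (v $ 2)) = integral\<^sup>L lebesgue ?G"
    by (subst integral_restrict_space) auto
  also have "\<dots> = integral\<^sup>L lborel ?G" using Gm by (intro integral_completion) simp
  also have "\<dots> = integral\<^sup>L (distr lborel borel plane_map) ?G" by (simp add: lborel_plane)
  also have "\<dots> = integral\<^sup>L lborel (\<lambda>p. ?G (plane_map p))"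
    by (rule integral_distr) (use Gm in auto)
  also have "\<dots> = integral\<^sup>L (lborel \<Otimes>\<^sub>M lborel) ?H" unfolding GH lborel_prod ..
  finally have *: "integral\<^sup>L (lebesgue_on (triangle h)) (\<lambda>v. F (v $ 1) (v $ 2)) = integral\<^sup>L (lborel \<Otimes>\<^sub>M lborel) ?H" .
  show "integral\<^sup>L (lebesgue_on (triangle h)) (\<lambda>v. F (v $ 1) (v $ 2)) =
      (LINT y|lborel. LINT x|lborel. of_bool (0 < y \<and> y < x \<and> x < h) * F x y)"
    unfolding * by (rule lborel_pair.integral_snd[OF Hi, symmetric])
  show "integral\<^sup>L (lebesgue_on (triangle h)) (\<lambda>v. F (v $ 1) (v $ 2)) =
      (LINT x|lborel. LINT y|lborel. of_bool (0 < y \<and> y < x \<and> x < h) * F x y)"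
    unfolding * by (rule lborel_pair.integral_fst[OF Hi, symmetric])
qed

lemma integral_Ioo:
  fixes f g :: "real \<Rightarrow> real"
  assumes f: "continuous_on {a..b} f" and g: "\<And>x. a < x \<Longrightarrow> x < b \<Longrightarrow> g x = f x"
  shows "(LINT x|lborel. of_bool (a < x \<and> x < b) * g x) = integral {a..b} f"
proof -
  have si: "set_integrable lborel {a..b} f"
    using borel_integrable_compact[OF _ f] by (simp add: set_integrable_def)
  have fm: "(\<lambda>x. indicator {a..b} x *\<^sub>R f x) \<in> borel_measurable lborel"
    using si by (auto simp: set_integrable_def)
  have "(LINT x|lborel. of_bool (a < x \<and> x < b) * g x) = (LINT x|lborel. indicator {a<..<b} x * (indicator {a..b} x *\<^sub>R f x))"
    by (intro Bochner_Integration.integral_cong) (auto simp: g indicator_def)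
  also have "\<dots> = (LINT x|lborel. indicator {a..b} x *\<^sub>R f x)"
  proof (rule integral_cong_AE)
    show "AE x in lborel. indicator {a<..<b} x * (indicator {a..b} x *\<^sub>R f x) = indicator {a..b} x *\<^sub>R f x"
      using AE_lborel_singleton[of a] AE_lborel_singleton[of b] by eventually_elim (auto simp: indicator_def)
  qed (use fm in auto)
  also have "\<dots> = integral {a..b} f"
    using set_borel_integral_eq_integral(2)[OF si] by (simp add: set_lebesgue_integral_def)
  finally show ?thesis .
qed

text \<open>
The horizontal half of the divergence theorem: the inner integral telescopes between the hypotenuse and
the leg.
\<close>

lemma integral_triangle_dx:
  fixes F P :: "real \<Rightarrow> real \<Rightarrow> real"
  assumes F: "continuous_on UNIV (\<lambda>v::real^2. F (v $ 1) (v $ 2))"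
    and P: "\<And>x y. ((\<lambda>x. P x y) has_real_derivative F x y) (at x)"
    and cP: "continuous_on UNIV (\<lambda>y. P h y - P y y)"
  shows "integral\<^sup>L (lebesgue_on (triangle h)) (\<lambda>v. F (v $ 1) (v $ 2)) = integral {0..h} (\<lambda>y. P h y - P y y)"
proof -
  have inner: "(LINT x|lborel. of_bool (0 < y \<and> y < x \<and> x < h) * F x y) = of_bool (0 < y \<and> y < h) * (P h y - P y y)" for y
  proof (cases "0 < y \<and> y < h")
    case True
    have c: "continuous_on {y..h} (\<lambda>x. F x y)"
    proof -
      have "continuous_on UNIV (\<lambda>x::real. vector [x, y] :: real^2)"
        by (intro continuous_intros)
      from continuous_on_compose2[OF F this] show ?thesis
        by (auto intro: continuous_on_subset)
    qed
    have "((\<lambda>x. F x y) has_integral (P h y - P y y)) {y..h}"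
      using True P by (intro fundamental_theorem_of_calculus)
        (auto simp: has_real_derivative_iff_has_vector_derivative[symmetric] intro: has_field_derivative_at_within)
    then have "integral {y..h} (\<lambda>x. F x y) = P h y - P y y" by (rule integral_unique)
    then show ?thesis using True integral_Ioo[OF c, of "\<lambda>x. F x y"] by simp
  next
    case False
    then have *: "(0 < y \<and> y < x \<and> x < h) = False" for x by auto
    show ?thesis using False unfolding * by simp
  qed
  show ?thesis unfolding integral_triangle_iterated(1)[OF F] inner
    by (rule integral_Ioo) (use cP in \<open>auto intro: continuous_on_subset\<close>)
qed

text \<open>
The vertical half: the inner integral telescopes between the bottom side and the hypotenuse.
\<close>

lemma integral_triangle_dy:
  fixes F Q :: "real \<Rightarrow> real \<Rightarrow> real"
  assumes F: "continuous_on UNIV (\<lambda>v::real^2. F (v $ 1) (v $ 2))"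
    and Q: "\<And>x y. ((\<lambda>y. Q x y) has_real_derivative F x y) (at y)"
    and cQ: "continuous_on UNIV (\<lambda>x. Q x x - Q x 0)"
  shows "integral\<^sup>L (lebesgue_on (triangle h)) (\<lambda>v. F (v $ 1) (v $ 2)) = integral {0..h} (\<lambda>x. Q x x - Q x 0)"
proof -
  have inner: "(LINT y|lborel. of_bool (0 < y \<and> y < x \<and> x < h) * F x y) = of_bool (0 < x \<and> x < h) * (Q x x - Q x 0)" for x
  proof (cases "0 < x \<and> x < h")
    case True
    have c: "continuous_on {0..x} (\<lambda>y. F x y)"
    proof -
      have "continuous_on UNIV (\<lambda>y::real. vector [x, y] :: real^2)"
        by (intro continuous_intros)
      from continuous_on_compose2[OF F this] show ?thesis
        by (auto intro: continuous_on_subset)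
    qed
    have "((\<lambda>y. F x y) has_integral (Q x x - Q x 0)) {0..x}"
      using True Q by (intro fundamental_theorem_of_calculus)
        (auto simp: has_real_derivative_iff_has_vector_derivative[symmetric] intro: has_field_derivative_at_within)
    then have "integral {0..x} (\<lambda>y. F x y) = Q x x - Q x 0" by (rule integral_unique)
    then show ?thesis using True integral_Ioo[OF c, of "\<lambda>y. F x y"] by simp
  next
    case False
    then have *: "(0 < y \<and> y < x \<and> x < h) = False" for y by auto
    show ?thesis using False unfolding * by simp
  qed
  show ?thesis unfolding integral_triangle_iterated(2)[OF F] inner
    by (rule integral_Ioo) (use cQ in \<open>auto intro: continuous_on_subset\<close>)
qed

section \<open>Smooth functions, bump functions and the fundamental lemma\<close>

lemma partial_derivI:
  "(f has_derivative f') (at x) \<Longrightarrow> partial_deriv b f x = f' b"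
  unfolding partial_deriv_def by (metis frechet_derivative_at)

lemma has_derivative_frechet:
  "f differentiable (at x) \<Longrightarrow> (f has_derivative (\<lambda>b. partial_deriv b f x)) (at x)"
  unfolding partial_deriv_def using frechet_derivative_works[of f "at x"] by simp

lemma C_k_SucD: "C_k (Suc k) f \<Longrightarrow> C_k k f"
proof (induction k arbitrary: f)
  case 0
  then show ?case by (auto intro!: continuous_at_imp_continuous_on differentiable_imp_continuous_within)
next
  case (Suc k)
  then show ?case by (metis C_k.simps(2))
qed

lemma C_k_add: "C_k k f \<Longrightarrow> C_k k g \<Longrightarrow> C_k k (\<lambda>x. f x + g x)"
proof (induction k arbitrary: f g)
  case 0
  then show ?case by (auto intro: continuous_on_add)
next
  case (Suc k)
  have "partial_deriv b (\<lambda>x. f x + g x) = (\<lambda>x. partial_deriv b f x + partial_deriv b g x)" for b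
    using Suc.prems by (auto intro!: ext partial_derivI[OF has_derivative_add] has_derivative_frechet)
  with Suc show ?case by (auto intro!: differentiable_add)
qed

lemma C_k_mult: "C_k k f \<Longrightarrow> C_k k g \<Longrightarrow> C_k k (\<lambda>x. f x * g x)"
proof (induction k arbitrary: f g)
  case 0
  then show ?case by (auto intro: continuous_on_mult)
next
  case (Suc k)
  have "partial_deriv b (\<lambda>x. f x * g x) = (\<lambda>x. f x * partial_deriv b g x + partial_deriv b f x * g x)" for b
    using Suc.prems by (auto intro!: ext partial_derivI[OF has_derivative_mult] has_derivative_frechet)
  moreover have "C_k k (\<lambda>x. f x * partial_deriv b g x + partial_deriv b f x * g x)" if "b \<in> Basis" for b
    using Suc.prems C_k_SucD[OF Suc.prems(1)] C_k_SucD[OF Suc.prems(2)] that by (intro C_k_add Suc.IH) auto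
  ultimately show ?case using Suc.prems by (auto intro!: differentiable_mult)
qed

lemma C_k_const: "C_k k (\<lambda>x. c)"
proof (induction k arbitrary: c)
  case (Suc k)
  have "partial_deriv b (\<lambda>x. c) = (\<lambda>x. 0)" for b :: 'a
    by (auto intro!: ext partial_derivI[OF has_derivative_const])
  with Suc show ?case by simp
qed auto

lemma smooth_add: "smooth f \<Longrightarrow> smooth g \<Longrightarrow> smooth (\<lambda>x. f x + g x)"
  and smooth_mult: "smooth f \<Longrightarrow> smooth g \<Longrightarrow> smooth (\<lambda>x. f x * g x)"
  and smooth_const: "smooth (\<lambda>x. c)"
  by (simp_all add: smooth_def C_k_add C_k_mult C_k_const)

lemma smooth_prod:
  "finite I \<Longrightarrow> (\<And>i. i \<in> I \<Longrightarrow> smooth (f i)) \<Longrightarrow> smooth (\<lambda>x. \<Prod>i\<in>I. f i x)"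
  by (induction rule: finite_induct) (auto intro: smooth_mult smooth_const)

text \<open>
Smoothness in one variable with the derivatives given as a sequence, so that an induction on the order can
start from any member.
\<close>

definition deriv_chain :: "(nat \<Rightarrow> real \<Rightarrow> real) \<Rightarrow> bool" where
  "deriv_chain F \<longleftrightarrow> (\<forall>n x. (F n has_real_derivative F (Suc n) x) (at x))"

lemma smooth_ridge:
  assumes "deriv_chain F"
  shows "smooth (\<lambda>x. F 0 (x \<bullet> a))"
proof -
  have "C_k k (\<lambda>x. c * F n (x \<bullet> a))" for k n c
  proof (induction k arbitrary: n c)
    case 0
    have "continuous_on UNIV (F n)"
      using assms by (auto simp: deriv_chain_def intro!: DERIV_continuous_on)
    then have "continuous_on UNIV (\<lambda>x. F n (x \<bullet> a))"
      by (rule continuous_on_compose2) (auto intro: continuous_intros)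
    then show ?case by (auto intro: continuous_intros)
  next
    case (Suc k)
    have d: "((\<lambda>x. c * F n (x \<bullet> a)) has_derivative (\<lambda>b. c * ((b \<bullet> a) * F (Suc n) (x \<bullet> a)))) (at x)" for x
    proof -
      have "(F n has_derivative (\<lambda>t. t * F (Suc n) (x \<bullet> a))) (at (x \<bullet> a))"
        using assms by (auto simp: deriv_chain_def has_field_derivative_def mult_commute_abs)
      with has_derivative_inner_left[OF has_derivative_ident]
      have "((\<lambda>x. F n (x \<bullet> a)) has_derivative (\<lambda>b. (b \<bullet> a) * F (Suc n) (x \<bullet> a))) (at x)"
        by (rule has_derivative_compose[where g = "F n" and f = "\<lambda>x. x \<bullet> a"])
      then show ?thesis by (rule has_derivative_mult_right)
    qed
    have "partial_deriv b (\<lambda>x. c * F n (x \<bullet> a)) = (\<lambda>x. (c * (b \<bullet> a)) * F (Suc n) (x \<bullet> a))" for b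
      using partial_derivI[OF d] by (auto simp: fun_eq_iff)
    with Suc d show ?case by (auto simp: differentiable_def)
  qed
  from this[of _ 1 0] show ?thesis by (simp add: smooth_def)
qed

lemma deriv_chain_affine:
  "deriv_chain F \<Longrightarrow> deriv_chain (\<lambda>n x. c ^ n * F n (c * x + d))"
  unfolding deriv_chain_def
proof (intro allI)
  fix n x assume F: "\<forall>n x. (F n has_real_derivative F (Suc n) x) (at x)"
  have "((\<lambda>x. F n (c * x + d)) has_real_derivative F (Suc n) (c * x + d) * c) (at x)"
    by (rule DERIV_chain2[where f = "F n"]) (use F in \<open>auto intro!: derivative_eq_intros\<close>)
  then show "((\<lambda>x. c ^ n * F n (c * x + d)) has_real_derivative c ^ Suc n * F (Suc n) (c * x + d)) (at x)"
    by (auto intro!: derivative_eq_intros)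
qed

text \<open>
The \<open>n\<close>-th derivative of \<open>exp (- 1 / x)\<close> is this polynomial in \<open>1 / x\<close> times \<open>exp (- 1 / x)\<close>.
\<close>

fun flat_poly :: "nat \<Rightarrow> real poly" where
  "flat_poly 0 = 1"
| "flat_poly (Suc n) = [:0, 0, 1:] * (flat_poly n - pderiv (flat_poly n))"

definition flat_deriv :: "nat \<Rightarrow> real \<Rightarrow> real" where
  "flat_deriv n x = (if x > 0 then poly (flat_poly n) (1 / x) * exp (- (1 / x)) else 0)"

lemma poly_exp_tendsto_0: "((\<lambda>t. poly p t * exp (- t)) \<longlongrightarrow> (0::real)) at_top"
proof -
  have "((\<lambda>t. \<Sum>i\<le>degree p. coeff p i * (t ^ i / exp t)) \<longlongrightarrow> (\<Sum>i\<le>degree p. coeff p i * 0)) at_top"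
    by (intro tendsto_sum tendsto_mult_left tendsto_power_div_exp_0)
  then show ?thesis
    by (simp add: poly_altdef sum_distrib_right exp_minus divide_inverse mult.assoc)
qed

lemma deriv_chain_flat: "deriv_chain flat_deriv"
  unfolding deriv_chain_def
proof (intro allI)
  fix n and x :: real
  consider "x > 0" | "x < 0" | "x = 0" by linarith
  then show "(flat_deriv n has_real_derivative flat_deriv (Suc n) x) (at x)"
  proof cases
    case 1
    have "((\<lambda>x. poly (flat_poly n) (1 / x) * exp (- (1 / x))) has_real_derivative flat_deriv (Suc n) x) (at x)"
      using 1 by (auto intro!: derivative_eq_intros DERIV_chain2[OF poly_DERIV] simp: flat_deriv_def field_simps power2_eq_square)
    then show ?thesis
      by (rule has_field_derivative_transform_within_open[where S = "{0<..}"]) (use 1 in \<open>auto simp: flat_deriv_def\<close>)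
  next
    case 2
    have "((\<lambda>x. 0) has_real_derivative flat_deriv (Suc n) x) (at x)"
      using 2 by (simp add: flat_deriv_def)
    then show ?thesis
      by (rule has_field_derivative_transform_within_open[where S = "{..<0}"]) (use 2 in \<open>auto simp: flat_deriv_def\<close>)
  next
    case 3
    have "((\<lambda>x. flat_deriv n x / x) \<longlongrightarrow> 0) (at_right 0)"
    proof -
      have "((\<lambda>t. poly ([:0, 1:] * flat_poly n) t * exp (- t)) \<longlongrightarrow> 0) at_top"
        by (rule poly_exp_tendsto_0)
      then have "((\<lambda>x. poly ([:0, 1:] * flat_poly n) (inverse x) * exp (- (inverse x))) \<longlongrightarrow> 0) (at_right 0)"
        by (rule filterlim_compose[OF _ filterlim_inverse_at_top_right])
      then show ?thesis
        by (rule Lim_transform_eventually)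
           (auto simp: eventually_at_right_field flat_deriv_def field_simps intro!: exI[of _ 1])
    qed
    moreover have "((\<lambda>x. flat_deriv n x / x) \<longlongrightarrow> 0) (at_left 0)"
      by (rule Lim_transform_eventually[of "\<lambda>x. 0"])
         (auto simp: eventually_at_left_field flat_deriv_def intro!: exI[of _ "-1"])
    ultimately have "((\<lambda>x. flat_deriv n x / x) \<longlongrightarrow> 0) (at 0)"
      by (simp add: filterlim_split_at)
    then show ?thesis using 3 by (simp add: DERIV_def flat_deriv_def)
  qed
qed

definition flat :: "real \<Rightarrow> real" where
  "flat x = (if x > 0 then exp (- (1 / x)) else 0)"

lemma flat_bounds: "0 \<le> flat x" "flat x \<le> 1" "x \<le> 0 \<Longrightarrow> flat x = 0"
  by (auto simp: flat_def)

lemma smooth_flat: "smooth (\<lambda>x. flat (c * (x \<bullet> a) + d))"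
proof -
  have "flat = flat_deriv 0" by (simp add: fun_eq_iff flat_def flat_deriv_def)
  then show ?thesis using smooth_ridge[OF deriv_chain_affine[OF deriv_chain_flat, of c d], of a] by simp
qed

lemma flat_scaled_tendsto_1: "x > 0 \<Longrightarrow> (\<lambda>n. flat (real n * x)) \<longlonglongrightarrow> 1"
proof -
  assume x: "x > 0"
  have "(\<lambda>n. exp (- (1 / x) * (1 / real n))) \<longlonglongrightarrow> exp (- (1 / x) * 0)"
    by (intro tendsto_intros lim_1_over_n)
  then have "(\<lambda>n. exp (- (1 / x) * (1 / real n))) \<longlonglongrightarrow> 1" by simp
  then show ?thesis
  proof (rule Lim_transform_eventually)
    show "\<forall>\<^sub>F n in sequentially. exp (- (1 / x) * (1 / real n)) = flat (real n * x)"
      using eventually_gt_at_top[of 0] by eventually_elim (use x in \<open>simp add: flat_def mult.commute\<close>)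
  qed
qed

text \<open>
The standard flat function, rescaled so that for growing \<open>n\<close> it tends to \<open>1\<close> inside the box. Since
\<open>flat (n x)\<close> is the \<open>n\<close>-th root of \<open>flat x\<close>, this needs no mollification.
\<close>

definition box_bump :: "'a::euclidean_space \<Rightarrow> 'a \<Rightarrow> nat \<Rightarrow> 'a \<Rightarrow> real" where
  "box_bump l u n x = (\<Prod>b\<in>Basis. flat (real n * (x \<bullet> b - l \<bullet> b)) * flat (real n * (u \<bullet> b - x \<bullet> b)))"

lemma box_bump_bounds: "0 \<le> box_bump l u n x" "box_bump l u n x \<le> 1"
  unfolding box_bump_def
  by (auto intro!: prod_nonneg prod_le_1 mult_le_one simp: flat_bounds)

lemma box_bump_eq_0: "x \<notin> box l u \<Longrightarrow> box_bump l u n x = 0"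
proof -
  assume "x \<notin> box l u"
  then obtain b where b: "b \<in> Basis" "x \<bullet> b - l \<bullet> b \<le> 0 \<or> u \<bullet> b - x \<bullet> b \<le> 0"
    by (auto simp: mem_box not_less)
  then have "flat (real n * (x \<bullet> b - l \<bullet> b)) * flat (real n * (u \<bullet> b - x \<bullet> b)) = 0"
    by (auto simp: flat_bounds(3) mult_nonneg_nonpos)
  then show ?thesis unfolding box_bump_def using b(1) by (intro prod_zero) auto
qed

lemma box_bump_tendsto: "(\<lambda>n. box_bump l u n x) \<longlonglongrightarrow> indicator (box l u) x"
proof (cases "x \<in> box l u")
  case True
  have "(\<lambda>n. box_bump l u n x) \<longlonglongrightarrow> (\<Prod>b\<in>(Basis::'a set). 1 * 1)"
    unfolding box_bump_def
    by (intro tendsto_prod tendsto_mult flat_scaled_tendsto_1) (use True in \<open>auto simp: mem_box\<close>)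
  then show ?thesis using True by simp
qed (simp add: box_bump_eq_0)

lemma smooth_box_bump: "smooth (box_bump l u n)"
proof -
  have "smooth (\<lambda>x. flat (real n * (x \<bullet> b - l \<bullet> b)) * flat (real n * (u \<bullet> b - x \<bullet> b)))" for b :: 'a
    using smooth_flat[of "real n" b "- real n * (l \<bullet> b)"] smooth_flat[of "- real n" b "real n * (u \<bullet> b)"]
    by (intro smooth_mult) (simp_all add: algebra_simps)
  then show ?thesis unfolding box_bump_def[abs_def] by (intro smooth_prod) auto
qed

lemma test_function_box_bump: "cbox l u \<subseteq> \<Omega> \<Longrightarrow> test_function \<Omega> (box_bump l u n)"
  unfolding test_function_def
  using smooth_box_bump box_bump_eq_0 box_subset_cbox[of l u] by (metis compact_cbox subsetD)

text \<open>
The Borel sets over which \<open>E\<close> integrates to zero form a Dynkin system containing the boxes.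
\<close>

lemma AE_zero_if_box_integrals_zero:
  fixes E :: "'a::euclidean_space \<Rightarrow> real"
  assumes E: "integrable lborel E"
    and box0: "\<And>l u. (LINT x:box l u|lborel. E x) = 0"
    and UNIV0: "integral\<^sup>L lborel E = 0"
  shows "AE x in lborel. E x = 0"
proof -
  have si: "set_integrable lborel B E" if "B \<in> sets lborel" for B
    unfolding set_integrable_def using integrable_mult_indicator[OF that E] .
  show ?thesis
  proof (rule sigma_finite_measure.density_zero[OF sigma_finite_lborel E])
    fix A :: "'a set" assume "A \<in> sets lborel"
    then have A: "A \<in> sigma_sets UNIV (range (\<lambda>(a, b). box a b))"
      by (simp add: borel_eq_box)
    have "Int_stable (range (\<lambda>(a, b). box a b :: 'a set))"
      by (auto simp: Int_stable_def box_Int_box)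
    moreover have "range (\<lambda>(a, b). box a b :: 'a set) \<subseteq> Pow UNIV" by simp
    ultimately show "(LINT x:A|lborel. E x) = 0"
      using A
    proof (induction rule: sigma_sets_induct_disjoint)
      case (basic A)
      then show ?case using box0 by auto
    next
      case (compl A)
      then have A: "A \<in> sets lborel" by (simp add: borel_eq_box)
      have "set_integrable lborel A E" "set_integrable lborel (UNIV - A) E"
        using A by (auto intro!: si)
      then have "(LINT x:A \<union> (UNIV - A)|lborel. E x) = (LINT x:A|lborel. E x) + (LINT x:(UNIV - A)|lborel. E x)"
        by (intro set_integral_Un) auto
      then show ?case using compl UNIV0 by (simp add: set_lebesgue_integral_def)
    next
      case (union A)
      have A: "A i \<in> sets lborel" for i
        using union(2) by (simp add: borel_eq_box image_subset_iff)
      have "(LINT x:(\<Union>i. A i)|lborel. E x) = (\<Sum>i. LINT x:A i|lborel. E x)"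
      proof (rule lebesgue_integral_countable_add)
        show "set_integrable lborel (\<Union>i. A i) E"
          using A by (intro si) auto
        show "A i \<inter> A j = {}" if "i \<noteq> j" for i j
          using union(1) that by (auto simp: disjoint_family_on_def)
      qed (use A in auto)
      then show ?case using union by simp
    qed (auto simp: set_lebesgue_integral_def)
  qed
qed

text \<open>
The fundamental lemma of the calculus of variations. The bumps converge boundedly to the indicator of a
box whose closure lies in \<open>\<Omega>\<close>, so \<open>D\<close> integrates to zero over all such boxes. These are closed under
intersection with arbitrary boxes, and countably many of their closures cover \<open>\<Omega>\<close>.
\<close>

lemma AE_zero_if_orthogonal_to_bumps:
  fixes D :: "'a::euclidean_space \<Rightarrow> real"
  assumes \<Omega>: "open \<Omega>" and D: "integrable (lebesgue_on \<Omega>) D"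
    and orth: "\<And>\<phi>. test_function \<Omega> \<phi> \<Longrightarrow> (\<And>x. 0 \<le> \<phi> x \<and> \<phi> x \<le> 1) \<Longrightarrow>
        \<phi> \<in> borel_measurable borel \<Longrightarrow> integral\<^sup>L (lebesgue_on \<Omega>) (\<lambda>x. D x * \<phi> x) = 0"
  shows "AE x in lebesgue_on \<Omega>. D x = 0"
proof -
  have \<Omega>m: "\<Omega> \<in> sets lebesgue" using \<Omega> by (simp add: borel_open)
  define D0 where "D0 x = indicator \<Omega> x * D x" for x
  have D0: "integrable lebesgue D0"
    using D \<Omega>m by (simp add: integrable_restrict_space D0_def[abs_def])
  have boxm: "box_bump l u n \<in> borel_measurable borel" for l u :: 'a and n
    using smooth_box_bump[of l u n] by (auto simp: smooth_def dest!: spec[of _ 0] intro: borel_measurable_continuous_onI)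
  have box0: "integral\<^sup>L lebesgue (\<lambda>x. indicator (box l u) x * D0 x) = 0" if "cbox l u \<subseteq> \<Omega>" for l u
  proof -
    have "(\<lambda>n. integral\<^sup>L lebesgue (\<lambda>x. box_bump l u n x * D0 x)) \<longlonglongrightarrow>
        integral\<^sup>L lebesgue (\<lambda>x. indicator (box l u) x * D0 x)"
    proof (rule integral_dominated_convergence[where w = "\<lambda>x. \<bar>D0 x\<bar>"])
      show "AE x in lebesgue. (\<lambda>n. box_bump l u n x * D0 x) \<longlonglongrightarrow> indicator (box l u) x * D0 x"
        by (intro AE_I2 tendsto_mult_right box_bump_tendsto)
      show "AE x in lebesgue. norm (box_bump l u n x * D0 x) \<le> \<bar>D0 x\<bar>" for n
        by (intro AE_I2) (simp add: abs_mult box_bump_bounds mult_left_le_one_le)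
      show "(\<lambda>x. box_bump l u n x * D0 x) \<in> borel_measurable lebesgue" for n
      proof (rule borel_measurable_times)
        show "box_bump l u n \<in> borel_measurable lebesgue"
          using boxm by (intro measurable_completion) simp
      qed (use D0 in auto)
      show "(\<lambda>x. indicator (box l u) x * D0 x) \<in> borel_measurable lebesgue"
        using D0 by (intro borel_measurable_times borel_measurable_indicator) auto
    qed (use D0 in auto)
    moreover have "integral\<^sup>L lebesgue (\<lambda>x. box_bump l u n x * D0 x) = 0" for n
    proof -
      have "0 = integral\<^sup>L (lebesgue_on \<Omega>) (\<lambda>x. D x * box_bump l u n x)"
        by (rule orth[OF test_function_box_bump[OF that], symmetric])
           (use boxm box_bump_bounds in auto)
      also have "\<dots> = integral\<^sup>L lebesgue (\<lambda>x. box_bump l u n x * D0 x)"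
        using \<Omega>m by (simp add: integral_restrict_space D0_def mult_ac)
      finally show ?thesis by simp
    qed
    ultimately show ?thesis by (simp add: LIMSEQ_const_iff)
  qed
  obtain D1 where D1: "D1 \<in> borel_measurable lborel" "AE x in lborel. D0 x = D1 x"
    using completion_ex_borel_measurable_real[of D0 lborel] D0 by auto
  have D1': "AE x in lebesgue. D0 x = D1 x" using D1(2) by (rule AE_completion)
  have D1m: "D1 \<in> borel_measurable lebesgue" using D1(1) by (rule measurable_completion)
  have D1i: "integrable lborel D1"
  proof -
    have "integrable lebesgue D1"
      using D0 by (rule integrable_cong_AE_imp) (use D1 D1' D1m in auto)
    then show ?thesis using D1 by (simp add: integrable_completion)
  qed
  have on_box: "AE x in lborel. x \<in> box l u \<longrightarrow> D1 x = 0" if sub: "cbox l u \<subseteq> \<Omega>" for l u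
  proof -
    let ?E = "\<lambda>x. indicator (box l u) x * D1 x"
    have E1: "integral\<^sup>L lborel (\<lambda>x. indicator (box l' u') x * D1 x) = 0" if "cbox l' u' \<subseteq> \<Omega>" for l' u'
    proof -
      have "integral\<^sup>L lborel (\<lambda>x. indicator (box l' u') x * D1 x) = integral\<^sup>L lebesgue (\<lambda>x. indicator (box l' u') x * D1 x)"
        using D1 by (intro integral_completion[symmetric]) auto
      also have "\<dots> = integral\<^sup>L lebesgue (\<lambda>x. indicator (box l' u') x * D0 x)"
        using D1m D1' D0 by (intro integral_cong_AE borel_measurable_times borel_measurable_indicator) auto
      finally show ?thesis using box0[OF that] by simp
    qed
    have "AE x in lborel. ?E x = 0"
    proof (rule AE_zero_if_box_integrals_zero)
      show "integrable lborel ?E"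
        using integrable_mult_indicator[OF _ D1i, of "box l u"] by simp
      show "integral\<^sup>L lborel ?E = 0" by (rule E1[OF sub])
      show "(LINT x:box l' u'|lborel. ?E x) = 0" for l' u'
      proof -
        obtain a b where ab: "box l u \<inter> box l' u' = box a b" using box_Int_box by blast
        have "(LINT x:box l' u'|lborel. ?E x) = integral\<^sup>L lborel (\<lambda>x. indicator (box a b) x * D1 x)"
          unfolding set_lebesgue_integral_def ab[symmetric]
          by (intro Bochner_Integration.integral_cong) (auto simp: indicator_def)
        also have "\<dots> = 0"
        proof (cases "box a b = {}")
          case False
          then have "cbox a b = closure (box a b)" by (simp add: closure_box)
          also have "\<dots> \<subseteq> cbox l u"
            using ab box_subset_cbox[of l u] by (intro closure_minimal) auto
          finally have "cbox a b \<subseteq> cbox l u" .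
          then show ?thesis using E1 sub by blast
        qed simp
        finally show ?thesis .
      qed
    qed
    then show ?thesis by eventually_elim auto
  qed
  obtain \<D> where \<D>: "countable \<D>" "\<D> \<subseteq> Pow \<Omega>"
      "\<And>X. X \<in> \<D> \<Longrightarrow> \<exists>a b. X = cbox a b" "\<Union>\<D> = \<Omega>"
    by (rule open_countable_Union_open_cbox[OF \<Omega>]) (rule that)
  have "AE x in lborel. \<forall>X\<in>\<D>. x \<in> X \<longrightarrow> D1 x = 0"
    unfolding AE_ball_countable[OF \<D>(1)]
  proof
    fix X assume "X \<in> \<D>"
    then obtain a b where X: "X = cbox a b" "cbox a b \<subseteq> \<Omega>" using \<D>(2,3) by blast
    have "cbox a b - box a b \<in> null_sets lborel"
      by (rule null_sets_cbox_Diff_box)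
    then have "AE x in lborel. x \<notin> cbox a b - box a b" by (rule AE_not_in)
    with on_box[OF X(2)] show "AE x in lborel. x \<in> X \<longrightarrow> D1 x = 0"
      unfolding X(1) by eventually_elim auto
  qed
  with D1(2) have "AE x in lborel. x \<in> \<Omega> \<longrightarrow> D x = 0"
  proof eventually_elim
    case (elim x)
    show ?case
    proof
      assume "x \<in> \<Omega>"
      then show "D x = 0" using elim \<D>(4) by (auto simp: D0_def)
    qed
  qed
  then have "AE x in lebesgue. x \<in> \<Omega> \<longrightarrow> D x = 0" by (rule AE_completion)
  then show ?thesis using \<Omega>m by (simp add: AE_restrict_space_iff)
qed

section \<open>Cosine series\<close>

definition freq :: "real \<Rightarrow> nat \<Rightarrow> real" where
  "freq h n = real n * pi / h"

definition cosine :: "real \<Rightarrow> nat \<Rightarrow> real \<Rightarrow> real" where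
  "cosine h n y = cos (freq h n * y)"

definition ip :: "real \<Rightarrow> (real \<Rightarrow> real) \<Rightarrow> (real \<Rightarrow> real) \<Rightarrow> real" where
  "ip h f g = integral {0..h} (\<lambda>y. f y * g y)"

text \<open>
The squared norm of the \<open>n\<close>-th cosine.
\<close>

definition cosine_weight :: "real \<Rightarrow> nat \<Rightarrow> real" where
  "cosine_weight h n = (if n = 0 then h else h / 2)"

lemma sin_freq: "h \<noteq> 0 \<Longrightarrow> sin (freq h n * h) = 0"
  and cos_freq: "h \<noteq> 0 \<Longrightarrow> cos (freq h n * h) = (- 1) ^ n"
  by (simp_all add: freq_def)

lemma continuous_on_cosine [continuous_intros]: "continuous_on S (cosine h n)"
  unfolding cosine_def[abs_def] by (intro continuous_intros)

lemma ip_commute: "ip h f g = ip h g f"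
  by (simp add: ip_def mult.commute)

lemma ip_add_left:
  assumes "continuous_on {0..h} f" "continuous_on {0..h} g" "continuous_on {0..h} k"
  shows "ip h (\<lambda>y. f y + g y) k = ip h f k + ip h g k"
  unfolding ip_def distrib_right
  by (intro Henstock_Kurzweil_Integration.integral_add integrable_continuous_real continuous_intros assms)

lemma ip_diff_left:
  assumes "continuous_on {0..h} f" "continuous_on {0..h} g" "continuous_on {0..h} k"
  shows "ip h (\<lambda>y. f y - g y) k = ip h f k - ip h g k"
  unfolding ip_def left_diff_distrib
  by (intro Henstock_Kurzweil_Integration.integral_diff integrable_continuous_real continuous_intros assms)

lemma ip_scale_left: "ip h (\<lambda>y. c * f y) g = c * ip h f g"
  by (simp add: ip_def mult.assoc)

lemma ip_sum_left:
  assumes "finite I" "\<And>i. i \<in> I \<Longrightarrow> continuous_on {0..h} (f i)" "continuous_on {0..h} g"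
  shows "ip h (\<lambda>y. \<Sum>i\<in>I. f i y) g = (\<Sum>i\<in>I. ip h (f i) g)"
  unfolding ip_def sum_distrib_right
  by (intro integral_sum integrable_continuous_real continuous_intros assms)

lemma ip_sum_right:
  assumes "finite I" "\<And>i. i \<in> I \<Longrightarrow> continuous_on {0..h} (f i)" "continuous_on {0..h} g"
  shows "ip h g (\<lambda>y. \<Sum>i\<in>I. f i y) = (\<Sum>i\<in>I. ip h g (f i))"
  using ip_sum_left[OF assms] by (simp add: ip_commute)

lemma ip_scale_right: "ip h f (\<lambda>y. c * g y) = c * ip h f g"
  by (metis ip_commute ip_scale_left)

lemma ip_nonneg: "continuous_on {0..h} f \<Longrightarrow> 0 \<le> ip h f f"
  unfolding ip_def by (intro integral_nonneg integrable_continuous_real continuous_intros) auto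

text \<open>
Lagrange's identity for two even solutions of \<open>f'' = \<alpha> f\<close> and \<open>g'' = \<beta> g\<close>. It yields every scalar
product of cosines and hyperbolic cosines below.
\<close>

lemma ip_eigenfunctions:
  fixes f g f1 g1 :: "real \<Rightarrow> real"
  assumes "0 \<le> h"
    and f: "\<And>y. (f has_real_derivative f1 y) (at y)" "\<And>y. (f1 has_real_derivative \<alpha> * f y) (at y)"
    and g: "\<And>y. (g has_real_derivative g1 y) (at y)" "\<And>y. (g1 has_real_derivative \<beta> * g y) (at y)"
    and zero: "f1 0 = 0" "g1 0 = 0"
  shows "(\<alpha> - \<beta>) * ip h f g = f1 h * g h - f h * g1 h"
proof -
  have "((\<lambda>y. f1 y * g y - f y * g1 y) has_real_derivative (\<alpha> - \<beta>) * (f y * g y)) (at y)" for y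
    by (auto intro!: derivative_eq_intros f g simp: algebra_simps)
  then have "((\<lambda>y. (\<alpha> - \<beta>) * (f y * g y)) has_integral
      (f1 h * g h - f h * g1 h) - (f1 0 * g 0 - f 0 * g1 0)) {0..h}"
    using assms(1) by (intro fundamental_theorem_of_calculus)
      (auto simp: has_real_derivative_iff_has_vector_derivative[symmetric] intro: has_field_derivative_at_within)
  then have "integral {0..h} (\<lambda>y. (\<alpha> - \<beta>) * (f y * g y)) = f1 h * g h - f h * g1 h"
    using zero by (auto dest: integral_unique)
  then show ?thesis by (simp add: ip_def)
qed

lemma cos_eigenfunction:
  "((\<lambda>y. cos (k * y)) has_real_derivative - k * sin (k * y)) (at y)"
  "((\<lambda>y. - k * sin (k * y)) has_real_derivative - (k^2) * cos (k * y)) (at y)"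
  by (auto intro!: derivative_eq_intros simp: power2_eq_square)

lemma cosh_eigenfunction:
  "((\<lambda>y. cosh (k * y)) has_real_derivative k * sinh (k * y)) (at y)"
  "((\<lambda>y. k * sinh (k * y)) has_real_derivative k^2 * cosh (k * y)) (at y)" for k y :: real
  by (auto intro!: derivative_eq_intros simp: power2_eq_square)

lemma ip_cosine_cosine:
  assumes "h > 0"
  shows "ip h (cosine h n) (cosine h m) = (if n = m then cosine_weight h n else 0)"
proof (cases "n = m")
  case False
  have "(- ((freq h n)^2) - (- ((freq h m)^2))) * ip h (cosine h n) (cosine h m) = 0"
    using ip_eigenfunctions[of h "\<lambda>y. cos (freq h n * y)" _ "- ((freq h n)^2)", OF _ cos_eigenfunction[of "freq h n"] cos_eigenfunction[of "freq h m"]] assms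
    by (simp add: cosine_def[abs_def] sin_freq)
  moreover have "freq h n ^ 2 \<noteq> freq h m ^ 2"
    using False assms by (simp add: freq_def power2_eq_iff_nonneg)
  ultimately show ?thesis using False by simp
next
  case True
  show ?thesis
  proof (cases "n = 0")
    case True
    then show ?thesis using \<open>n = m\<close> assms by (simp add: ip_def cosine_def freq_def cosine_weight_def)
  next
    case False
    let ?k = "freq h n"
    have k: "?k \<noteq> 0" using False assms by (simp add: freq_def)
    have "((\<lambda>y. y / 2 + sin (?k * y) * cos (?k * y) / (2 * ?k)) has_real_derivative cos (?k * y) * cos (?k * y)) (at y)" for y
    proof -
      have "((\<lambda>y. y / 2 + sin (?k * y) * cos (?k * y) / (2 * ?k)) has_real_derivative
          1 / 2 + (cos (?k * y) * cos (?k * y) - sin (?k * y) * sin (?k * y)) / 2) (at y)"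
        using k by (auto intro!: derivative_eq_intros simp: field_simps)
      moreover have "1 / 2 + (cos (?k * y) * cos (?k * y) - sin (?k * y) * sin (?k * y)) / 2 = cos (?k * y) * cos (?k * y)"
        using sin_cos_squared_add[of "?k * y"] by (simp add: field_simps power2_eq_square)
      ultimately show ?thesis by simp
    qed
    then have "((\<lambda>y. cos (?k * y) * cos (?k * y)) has_integral
        (h / 2 + sin (?k * h) * cos (?k * h) / (2 * ?k)) - (0 / 2 + sin (?k * 0) * cos (?k * 0) / (2 * ?k))) {0..h}"
      using assms by (intro fundamental_theorem_of_calculus)
        (auto simp: has_real_derivative_iff_has_vector_derivative[symmetric] intro: has_field_derivative_at_within)
    then have "integral {0..h} (\<lambda>y. cos (?k * y) * cos (?k * y)) = h / 2"
      using assms by (auto simp: sin_freq dest: integral_unique)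
    then show ?thesis using \<open>n = m\<close> False by (simp add: ip_def cosine_def cosine_weight_def)
  qed
qed

lemma cosine_sum_error:
  assumes h: "h > 0" and f: "continuous_on {0..h} f" and I: "finite I"
  shows "ip h (\<lambda>y. f y - (\<Sum>n\<in>I. d n * cosine h n y)) (\<lambda>y. f y - (\<Sum>n\<in>I. d n * cosine h n y)) =
    ip h f f - 2 * (\<Sum>n\<in>I. d n * ip h f (cosine h n)) + (\<Sum>n\<in>I. (d n)\<^sup>2 * cosine_weight h n)"
proof -
  define q where "q y = (\<Sum>n\<in>I. d n * cosine h n y)" for y
  have cq: "continuous_on {0..h} q" unfolding q_def[abs_def] by (intro continuous_intros)
  have fq: "ip h f q = (\<Sum>n\<in>I. d n * ip h f (cosine h n))"
    unfolding q_def[abs_def] using I f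
    by (subst ip_sum_right) (auto intro!: continuous_intros simp: ip_scale_right)
  have "ip h (cosine h n) q = (\<Sum>m\<in>I. d m * ip h (cosine h n) (cosine h m))" for n
    unfolding q_def[abs_def] using I
    by (subst ip_sum_right) (auto intro!: continuous_intros simp: ip_scale_right)
  then have cnq: "ip h (cosine h n) q = d n * cosine_weight h n" if "n \<in> I" for n
    using I h that by (simp add: ip_cosine_cosine if_distrib[of "\<lambda>x. _ * x"] sum.delta cong: if_cong)
  have qq: "ip h q q = (\<Sum>n\<in>I. (d n)\<^sup>2 * cosine_weight h n)"
  proof -
    have "ip h q q = (\<Sum>n\<in>I. d n * ip h (cosine h n) q)"
      unfolding q_def[abs_def] using I
      by (subst ip_sum_left) (auto intro!: continuous_intros simp: ip_scale_left)
    then show ?thesis using cnq by (simp add: power2_eq_square mult.assoc)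
  qed
  have "ip h (\<lambda>y. f y - q y) (\<lambda>y. f y - q y) = ip h f (\<lambda>y. f y - q y) - ip h q (\<lambda>y. f y - q y)"
    by (intro ip_diff_left continuous_intros f cq)
  also have "\<dots> = ip h f f - ip h q f - (ip h f q - ip h q q)"
    using ip_diff_left[OF f cq f] ip_diff_left[OF f cq cq] by (simp add: ip_commute)
  finally show ?thesis unfolding fq qq[symmetric] q_def[symmetric] using fq by (simp add: ip_commute)
qed

lemma cos_times_cos_step:
  "cos t * cos (real n * t) = (cos (real (n + 1) * t) + cos (real (if n = 0 then 1 else n - 1) * t)) / 2"
proof (cases n)
  case (Suc m)
  have "cos (real (n + 1) * t) = cos (real n * t + t)" "cos (real m * t) = cos (real n * t - t)"
    using Suc by (simp_all add: algebra_simps)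
  then show ?thesis using Suc by (simp add: cos_add cos_diff)
qed simp

definition cosine_poly :: "real \<Rightarrow> (real \<Rightarrow> real) \<Rightarrow> bool" where
  "cosine_poly h f \<longleftrightarrow> (\<exists>N d. f = (\<lambda>y. \<Sum>n\<le>N. d n * cosine h n y))"

lemma cosine_poly_extend:
  assumes "N \<le> M"
  shows "(\<Sum>n\<le>N. d n * cosine h n y) = (\<Sum>n\<le>M. (if n \<le> N then d n else 0) * cosine h n y)"
  by (rule sum.mono_neutral_cong_left) (use assms in auto)

lemma cosine_poly_cosine: "cosine_poly h (cosine h n)"
  unfolding cosine_poly_def
  by (intro exI[of _ n] exI[of _ "\<lambda>m. if m = n then 1 else 0"])
     (auto simp: fun_eq_iff if_distrib[of "\<lambda>x. x * _"] sum.delta cong: if_cong)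

lemma cosine_poly_scale: "cosine_poly h f \<Longrightarrow> cosine_poly h (\<lambda>y. c * f y)"
proof -
  assume "cosine_poly h f"
  then obtain N d where f: "f = (\<lambda>y. \<Sum>n\<le>N. d n * cosine h n y)"
    unfolding cosine_poly_def by blast
  show ?thesis unfolding cosine_poly_def f
    by (intro exI[of _ N] exI[of _ "\<lambda>n. c * d n"]) (simp add: sum_distrib_left mult.assoc)
qed

lemma cosine_poly_add: "cosine_poly h f \<Longrightarrow> cosine_poly h g \<Longrightarrow> cosine_poly h (\<lambda>y. f y + g y)"
proof -
  assume "cosine_poly h f" "cosine_poly h g"
  then obtain N d M e where fg: "f = (\<lambda>y. \<Sum>n\<le>N. d n * cosine h n y)" "g = (\<lambda>y. \<Sum>n\<le>M. e n * cosine h n y)"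
    unfolding cosine_poly_def by blast
  have "f y + g y = (\<Sum>n\<le>max N M. ((if n \<le> N then d n else 0) + (if n \<le> M then e n else 0)) * cosine h n y)" for y
    unfolding fg using cosine_poly_extend[of N "max N M" d h y] cosine_poly_extend[of M "max N M" e h y]
    by (simp add: distrib_right sum.distrib)
  then show ?thesis unfolding cosine_poly_def
    by (intro exI[of _ "max N M"] exI[of _ "\<lambda>n. (if n \<le> N then d n else 0) + (if n \<le> M then e n else 0)"]) blast
qed

lemma cosine_poly_sum: "finite I \<Longrightarrow> (\<And>i. i \<in> I \<Longrightarrow> cosine_poly h (f i)) \<Longrightarrow> cosine_poly h (\<lambda>y. \<Sum>i\<in>I. f i y)"
proof (induction rule: finite_induct)
  case empty
  then show ?case using cosine_poly_scale[OF cosine_poly_cosine, of h 0 0] by simp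
next
  case (insert i I)
  then show ?case by (simp add: cosine_poly_add)
qed

lemma cosine_poly_mult_cosine:
  assumes "cosine_poly h f" shows "cosine_poly h (\<lambda>y. cosine h 1 y * f y)"
proof -
  obtain N d where f: "f = (\<lambda>y. \<Sum>n\<le>N. d n * cosine h n y)"
    using assms unfolding cosine_poly_def by blast
  have step: "cosine h 1 y * cosine h n y = (1/2) * (cosine h (n + 1) y + cosine h (if n = 0 then 1 else n - 1) y)" for n y
    using cos_times_cos_step[of "pi / h * y" n] unfolding cosine_def freq_def by (simp add: mult.assoc)
  have "cosine h 1 y * f y = (\<Sum>n\<le>N. d n * ((1/2) * (cosine h (n + 1) y + cosine h (if n = 0 then 1 else n - 1) y)))" for y
    unfolding f sum_distrib_left mult.left_commute[of "cosine h 1 y"] step ..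
  then have eq: "(\<lambda>y. cosine h 1 y * f y) = (\<lambda>y. \<Sum>n\<le>N. d n * ((1/2) * (cosine h (n + 1) y + cosine h (if n = 0 then 1 else n - 1) y)))"
    by (rule ext)
  show ?thesis unfolding eq
    by (intro cosine_poly_sum cosine_poly_scale cosine_poly_add cosine_poly_cosine) simp
qed

lemma cosine_poly_poly: "cosine_poly h (\<lambda>y. poly p (cosine h 1 y))"
proof (induction p)
  case 0
  then show ?case using cosine_poly_scale[OF cosine_poly_cosine, of h 0 0] by simp
next
  case (pCons a p)
  have "cosine_poly h (\<lambda>y. a * cosine h 0 y + cosine h 1 y * poly p (cosine h 1 y))"
    by (intro cosine_poly_add cosine_poly_scale cosine_poly_cosine cosine_poly_mult_cosine pCons)
  then show ?case by (simp add: cosine_def freq_def)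
qed

text \<open>
Polynomials in \<open>cos (pi y / h)\<close> separate the points of \<open>[0, h]\<close>, so Stone-Weierstrass applies, and they
are cosine polynomials.
\<close>

lemma cosine_dense:
  assumes h: "h > 0" and f: "continuous_on {0..h} f" and e: "e > 0"
  obtains N d where "\<And>y. y \<in> {0..h} \<Longrightarrow> \<bar>f y - (\<Sum>n\<le>N. d n * cosine h n y)\<bar> < e"
proof -
  interpret R: function_ring_on "range (\<lambda>p y. poly p (cosine h 1 y))" "{0..h}"
  proof
    show "(\<lambda>y. F y + G y) \<in> range (\<lambda>p y. poly p (cosine h 1 y))"
      if "F \<in> range (\<lambda>p y. poly p (cosine h 1 y))" "G \<in> range (\<lambda>p y. poly p (cosine h 1 y))" for F G
      using that by (auto simp: image_iff fun_eq_iff) (metis poly_add)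
    show "(\<lambda>y. F y * G y) \<in> range (\<lambda>p y. poly p (cosine h 1 y))"
      if "F \<in> range (\<lambda>p y. poly p (cosine h 1 y))" "G \<in> range (\<lambda>p y. poly p (cosine h 1 y))" for F G
      using that by (auto simp: image_iff fun_eq_iff) (metis poly_mult)
    show "(\<lambda>_. c) \<in> range (\<lambda>p y. poly p (cosine h 1 y))" for c
      by (rule range_eqI[of _ _ "[:c:]"]) simp
    show "\<exists>F\<in>range (\<lambda>p y. poly p (cosine h 1 y)). F x \<noteq> F y" if "x \<in> {0..h}" "y \<in> {0..h}" "x \<noteq> y" for x y
    proof -
      have "cosine h 1 x \<noteq> cosine h 1 y"
        using that h by (auto simp: cosine_def freq_def divide_simps mult_le_cancel_left dest!: cos_inj_pi[rotated 4])
      moreover have "cosine h 1 \<in> range (\<lambda>p y. poly p (cosine h 1 y))"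
        by (rule range_eqI[of _ _ "[:0, 1:]"]) simp
      ultimately show ?thesis by blast
    qed
  qed (auto intro!: continuous_intros)
  obtain p where p: "\<forall>y\<in>{0..h}. \<bar>f y - poly p (cosine h 1 y)\<bar> < e"
    using R.Stone_Weierstrass_basic[OF f e] by blast
  obtain N d where "(\<lambda>y. poly p (cosine h 1 y)) = (\<lambda>y. \<Sum>n\<le>N. d n * cosine h n y)"
    using cosine_poly_poly unfolding cosine_poly_def by blast
  then have "\<And>y. poly p (cosine h 1 y) = (\<Sum>n\<le>N. d n * cosine h n y)" by (rule fun_cong)
  with p show ?thesis by (intro that[of d N]) simp
qed

text \<open>
Bessel's inequality bounds the partial sums from above. They are eventually close to the squared norm since
the cosine partial sum is the best mean-square approximation and uniform approximations exist.
\<close>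

lemma parseval:
  assumes h: "h > 0" and f: "continuous_on {0..h} f"
  shows "(\<lambda>n. (ip h f (cosine h n))\<^sup>2 / cosine_weight h n) sums ip h f f"
proof -
  define a where "a n = (ip h f (cosine h n))\<^sup>2 / cosine_weight h n" for n
  have w: "cosine_weight h n > 0" for n using h by (simp add: cosine_weight_def)
  have a0: "a n \<ge> 0" for n using w[of n] by (simp add: a_def)
  have bessel: "sum a {..N} \<le> ip h f f" for N
  proof -
    let ?d = "\<lambda>n. ip h f (cosine h n) / cosine_weight h n"
    have "0 \<le> ip h (\<lambda>y. f y - (\<Sum>n\<le>N. ?d n * cosine h n y)) (\<lambda>y. f y - (\<Sum>n\<le>N. ?d n * cosine h n y))"
      by (intro ip_nonneg continuous_intros f)
    also have "\<dots> = ip h f f - 2 * sum a {..N} + sum a {..N}"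
      unfolding cosine_sum_error[OF h f finite_atMost] a_def
      using w by (simp add: power2_eq_square less_imp_neq[symmetric] field_simps)
    finally show ?thesis by simp
  qed
  have dense: "\<exists>N. ip h f f - e < sum a {..N}" if e: "e > 0" for e
  proof -
    \<comment> \<open>Chosen so that both \<open>\<delta>\<^sup>2 \<le> \<delta>\<close> and \<open>\<delta> * h < e\<close>.\<close>
    define \<delta> where "\<delta> = min 1 (e / (2 * h))"
    have \<delta>: "\<delta> > 0" "\<delta>\<^sup>2 * h < e"
    proof -
      show "\<delta> > 0" using e h by (simp add: \<delta>_def)
      have "\<delta> \<le> 1" by (simp add: \<delta>_def)
      then have "\<delta>\<^sup>2 \<le> \<delta>" using \<open>\<delta> > 0\<close> mult_left_le[of \<delta> \<delta>] by (simp add: power2_eq_square)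
      also have "\<dots> \<le> e / (2 * h)" by (simp add: \<delta>_def)
      finally have "\<delta>\<^sup>2 * h \<le> e / 2" using h by (simp add: field_simps)
      then show "\<delta>\<^sup>2 * h < e" using e by simp
    qed
    obtain N d where Nd: "\<And>y. y \<in> {0..h} \<Longrightarrow> \<bar>f y - (\<Sum>n\<le>N. d n * cosine h n y)\<bar> < \<delta>"
      using cosine_dense[OF h f \<delta>(1)] by blast
    define r where "r y = f y - (\<Sum>n\<le>N. d n * cosine h n y)" for y
    have "ip h r r \<le> integral {0..h} (\<lambda>y. \<delta>\<^sup>2)"
      unfolding ip_def
    proof (rule integral_le)
      show "(\<lambda>y. r y * r y) integrable_on {0..h}"
        unfolding r_def by (intro integrable_continuous_real continuous_intros f)
      show "r y * r y \<le> \<delta>\<^sup>2" if "y \<in> {0..h}" for y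
      proof -
        have "\<bar>r y\<bar>\<^sup>2 \<le> \<delta>\<^sup>2" using Nd[OF that] unfolding r_def by (intro power_mono) auto
        then show ?thesis by (simp add: power2_eq_square)
      qed
    qed auto
    also have "\<dots> < e" using \<delta> h by (simp add: mult.commute)
    finally have "ip h r r < e" .
    moreover have "ip h r r = ip h f f - 2 * (\<Sum>n\<le>N. d n * ip h f (cosine h n)) + (\<Sum>n\<le>N. (d n)\<^sup>2 * cosine_weight h n)"
      unfolding r_def by (rule cosine_sum_error[OF h f]) simp
    moreover have "2 * (\<Sum>n\<le>N. d n * ip h f (cosine h n)) - (\<Sum>n\<le>N. (d n)\<^sup>2 * cosine_weight h n) \<le> sum a {..N}"
      unfolding sum_distrib_left sum_subtractf[symmetric]
    proof (rule sum_mono)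
      fix n
      let ?w = "cosine_weight h n" and ?b = "ip h f (cosine h n)"
      have "0 \<le> (d n * ?w - ?b)\<^sup>2 / ?w" using w[of n] by simp
      also have "\<dots> = (d n)\<^sup>2 * ?w - 2 * (d n * ?b) + a n"
        using w[of n] by (simp add: a_def power2_diff field_simps power2_eq_square)
      finally show "2 * (d n * ?b) - (d n)\<^sup>2 * ?w \<le> a n" by simp
    qed
    ultimately show ?thesis by (intro exI[of _ N]) linarith
  qed
  have "(\<lambda>N. sum a {..N}) \<longlonglongrightarrow> ip h f f"
  proof (rule LIMSEQ_I)
    fix e :: real assume "0 < e"
    then obtain N where N: "ip h f f - e < sum a {..N}" using dense by blast
    have "norm (sum a {..n} - ip h f f) < e" if "n \<ge> N" for n
    proof -
      have "sum a {..N} \<le> sum a {..n}" using that a0 by (intro sum_mono2) auto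
      then show ?thesis using N bessel[of n] by simp
    qed
    then show "\<exists>no. \<forall>n\<ge>no. norm (sum a {..n} - ip h f f) < e" by blast
  qed
  then show ?thesis unfolding sums_def_le a_def .
qed

text \<open>
By polarisation of the preceding identity.
\<close>

lemma parseval_product:
  assumes h: "h > 0" and f: "continuous_on {0..h} f" and g: "continuous_on {0..h} g"
  shows "(\<lambda>n. ip h f (cosine h n) * ip h g (cosine h n) / cosine_weight h n) sums ip h f g"
proof -
  let ?p = "\<lambda>y. f y + g y" and ?m = "\<lambda>y. f y - g y"
  have c: "continuous_on {0..h} ?p" "continuous_on {0..h} ?m" by (intro continuous_intros f g)+
  have "(\<lambda>n. ((ip h ?p (cosine h n))\<^sup>2 / cosine_weight h n - (ip h ?m (cosine h n))\<^sup>2 / cosine_weight h n) / 4)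
      sums ((ip h ?p ?p - ip h ?m ?m) / 4)"
    by (intro sums_divide sums_diff parseval h c)
  moreover have "((ip h ?p (cosine h n))\<^sup>2 / cosine_weight h n - (ip h ?m (cosine h n))\<^sup>2 / cosine_weight h n) / 4
      = ip h f (cosine h n) * ip h g (cosine h n) / cosine_weight h n" for n
    unfolding ip_add_left[OF f g continuous_on_cosine] ip_diff_left[OF f g continuous_on_cosine]
    by (simp add: diff_divide_distrib[symmetric] power2_eq_square algebra_simps)
  moreover have "(ip h ?p ?p - ip h ?m ?m) / 4 = ip h f g"
    using ip_add_left[OF f g c(1)] ip_diff_left[OF f g c(2)]
      ip_add_left[OF f g f] ip_add_left[OF f g g] ip_diff_left[OF f g f] ip_diff_left[OF f g g]
    by (simp add: ip_commute)
  ultimately show ?thesis by simp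
qed

section \<open>The Steklov form in the cosine basis\<close>

lemma freq_pos: "h > 0 \<Longrightarrow> n \<ge> 1 \<Longrightarrow> freq h n > 0"
  by (simp add: freq_def)

lemma ip_cosine_cosh:
  assumes h: "h > 0" and k: "k \<noteq> 0"
  shows "ip h (cosine h n) (\<lambda>y. cosh (k * y)) = (- 1) ^ n * k * sinh (k * h) / ((freq h n)\<^sup>2 + k\<^sup>2)"
proof -
  have "(- ((freq h n)\<^sup>2) - k\<^sup>2) * ip h (cosine h n) (\<lambda>y. cosh (k * y)) = - ((- 1) ^ n * (k * sinh (k * h)))"
    using ip_eigenfunctions[of h "\<lambda>y. cos (freq h n * y)" _ "- ((freq h n)^2)", OF _ cos_eigenfunction[of "freq h n"] cosh_eigenfunction[of k]] h
    by (simp add: cosine_def[abs_def] sin_freq cos_freq)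
  moreover have "(freq h n)\<^sup>2 + k\<^sup>2 \<noteq> 0" using k by (simp add: sum_power2_eq_zero_iff)
  ultimately show ?thesis by (simp add: field_simps)
qed

lemma ip_cosine_cos:
  assumes h: "h > 0" and k: "k\<^sup>2 \<noteq> (freq h n)\<^sup>2"
  shows "ip h (cosine h n) (\<lambda>y. cos (k * y)) = (- 1) ^ n * k * sin (k * h) / (k\<^sup>2 - (freq h n)\<^sup>2)"
proof -
  have "(- ((freq h n)\<^sup>2) - (- (k\<^sup>2))) * ip h (cosine h n) (\<lambda>y. cos (k * y)) = (- 1) ^ n * (k * sin (k * h))"
    using ip_eigenfunctions[of h "\<lambda>y. cos (freq h n * y)" _ "- ((freq h n)^2)", OF _ cos_eigenfunction[of "freq h n"] cos_eigenfunction[of k]] h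
    by (simp add: cosine_def[abs_def] sin_freq cos_freq)
  then show ?thesis using k by (simp add: field_simps)
qed

text \<open>
The condition \<open>z < pi\<close> singles out the lowest mode: it puts \<open>z / h\<close> below the first nonzero cosine
frequency, which makes the eigenvector \<open>perron\<close> positive.
\<close>

locale leg_mode =
  fixes h z :: real
  assumes h: "h > 0" and z: "pi / 2 < z" "z < pi"
    and root: "sin z * cosh z + cos z * sinh z = 0"
begin

definition k :: real where "k = z / h"

definition eigval :: real where "eigval = z / h * tanh z"

definition amp :: real where "amp = cosh z * sin z"

text \<open>
The trace of the extremal function on the leg.
\<close>

definition mode_trace :: "real \<Rightarrow> real" where
  "mode_trace y = cosh z * cos (k * y) + cos z * cosh (k * y)"

text \<open>
The cosine coefficients of \<open>mode_trace\<close> up to the sign \<open>(- 1) ^ n\<close> and a constant. The value at \<open>n = 0\<close> is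
\<open>0\<close>, which expresses that \<open>mode_trace\<close> is mean-free.
\<close>

definition perron :: "nat \<Rightarrow> real" where
  "perron n = (freq h n)\<^sup>2 / ((freq h n) ^ 4 - k ^ 4)"

lemma z_pos: "z > 0" using z pi_gt_zero by linarith

lemma k_pos: "k > 0" using z_pos h by (simp add: k_def)

lemma kh: "k * h = z" using h by (simp add: k_def)

lemma hk: "h * k = z" using h by (simp add: k_def)

lemma tanh_pos: "tanh z > 0" using z_pos by simp

lemma eigval_pos: "eigval > 0" using tanh_pos z_pos h by (simp add: eigval_def)

lemma eigval_eq: "eigval = k * tanh z" by (simp add: eigval_def k_def)

lemma amp_pos: "amp > 0" using sin_gt_zero[OF z_pos z(2)] by (simp add: amp_def)

lemma cos_sinh: "cos z * sinh z = - amp" using root by (simp add: amp_def mult.commute)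

lemma k_less_freq: "n \<ge> 1 \<Longrightarrow> k < freq h n"
proof -
  assume "n \<ge> 1"
  then have "1 * pi \<le> real n * pi" by (intro mult_right_mono) auto
  then have "z < real n * pi" using z by linarith
  then show ?thesis using h by (simp add: k_def freq_def divide_strict_right_mono)
qed

lemma perron_pos: "n \<ge> 1 \<Longrightarrow> perron n > 0"
proof -
  assume n: "n \<ge> 1"
  have "k ^ 4 < freq h n ^ 4" using k_less_freq[OF n] k_pos by (intro power_strict_mono) auto
  then show ?thesis using freq_pos[OF h n] by (simp add: perron_def)
qed

lemma perron_0: "perron 0 = 0" by (simp add: perron_def freq_def)

lemma k_freq_neq: "k\<^sup>2 \<noteq> (freq h n)\<^sup>2"
proof (cases "n = 0")
  case True
  then show ?thesis using k_pos by (simp add: freq_def)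
next
  case False
  then have "k\<^sup>2 < (freq h n)\<^sup>2" using k_less_freq[of n] k_pos by (intro power_strict_mono) auto
  then show ?thesis by simp
qed

lemma continuous_on_mode: "continuous_on S mode_trace"
  unfolding mode_trace_def[abs_def] by (intro continuous_intros)

text \<open>
The frequency equation turns \<open>cos z * sinh z\<close> into \<open>- amp\<close>, so the contributions of the trigonometric and
the hyperbolic part share the factor \<open>amp\<close> and combine into one fraction.
\<close>

lemma ip_mode_cosine: "ip h mode_trace (cosine h n) = - ((- 1) ^ n * (2 * k * amp * perron n))"
proof -
  let ?v = "freq h n"
  have "ip h mode_trace (cosine h n) = cosh z * ip h (cosine h n) (\<lambda>y. cos (k * y)) + cos z * ip h (cosine h n) (\<lambda>y. cosh (k * y))"
    unfolding mode_trace_def[abs_def]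
    by (subst ip_add_left) (auto intro!: continuous_intros simp: ip_scale_left ip_commute)
  also have "\<dots> = (- 1) ^ n * k * (cosh z * sin z / (k\<^sup>2 - ?v\<^sup>2) + cos z * sinh z / (?v\<^sup>2 + k\<^sup>2))"
    unfolding ip_cosine_cos[OF h k_freq_neq] ip_cosine_cosh[OF h less_imp_neq[OF k_pos, symmetric]] kh
    by (simp add: algebra_simps)
  also have "\<dots> = (- 1) ^ n * k * amp * (1 / (k\<^sup>2 - ?v\<^sup>2) - 1 / (?v\<^sup>2 + k\<^sup>2))"
    unfolding cos_sinh by (simp add: amp_def algebra_simps)
  also have "1 / (k\<^sup>2 - ?v\<^sup>2) - 1 / (?v\<^sup>2 + k\<^sup>2) = - 2 * perron n"
  proof -
    have n0: "k\<^sup>2 - ?v\<^sup>2 \<noteq> 0" "?v\<^sup>2 + k\<^sup>2 \<noteq> 0" using k_freq_neq k_pos by (auto simp: sum_power2_eq_zero_iff)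
    have "1 / (k\<^sup>2 - ?v\<^sup>2) - 1 / (?v\<^sup>2 + k\<^sup>2) = 2 * ?v\<^sup>2 / ((k\<^sup>2 - ?v\<^sup>2) * (?v\<^sup>2 + k\<^sup>2))"
      using n0 by (simp add: diff_frac_eq)
    also have "(k\<^sup>2 - ?v\<^sup>2) * (?v\<^sup>2 + k\<^sup>2) = - (?v ^ 4 - k ^ 4)" by algebra
    finally show ?thesis unfolding perron_def by (simp del: minus_diff_eq)
  qed
  finally show ?thesis by simp
qed

lemma ip_mode_cosh:
  assumes m: "m \<ge> 1"
  shows "ip h mode_trace (\<lambda>y. cosh (freq h m * y)) =
    2 * perron m * amp * (k * cosh (freq h m * h) - freq h m * sinh (freq h m * h) / tanh z)"
proof -
  let ?v = "freq h m" let ?S = "sinh (freq h m * h)" and ?C = "cosh (freq h m * h)"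
  have n0: "?v\<^sup>2 - k\<^sup>2 \<noteq> 0" "?v\<^sup>2 + k\<^sup>2 \<noteq> 0"
    using k_freq_neq[of m] k_pos by (auto simp: sum_power2_eq_zero_iff)
  have "(?v\<^sup>2 + k\<^sup>2) * ip h (\<lambda>y. cosh (?v * y)) (\<lambda>y. cos (k * y)) = ?v * ?S * cos z + k * ?C * sin z"
    using ip_eigenfunctions[of h "\<lambda>y. cosh (?v * y)" _ "?v^2", OF _ cosh_eigenfunction[of ?v] cos_eigenfunction[of k]] h
    by (simp add: hk mult_ac)
  then have 1: "ip h (\<lambda>y. cosh (?v * y)) (\<lambda>y. cos (k * y)) = (?v * ?S * cos z + k * ?C * sin z) / (?v\<^sup>2 + k\<^sup>2)"
    using n0(2) by (simp add: eq_divide_eq mult.commute)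
  have "(?v\<^sup>2 - k\<^sup>2) * ip h (\<lambda>y. cosh (?v * y)) (\<lambda>y. cosh (k * y)) = ?v * ?S * cosh z - k * ?C * sinh z"
    using ip_eigenfunctions[of h "\<lambda>y. cosh (?v * y)" _ "?v^2", OF _ cosh_eigenfunction[of ?v] cosh_eigenfunction[of k]] h
    by (simp add: hk mult_ac)
  then have 2: "ip h (\<lambda>y. cosh (?v * y)) (\<lambda>y. cosh (k * y)) = (?v * ?S * cosh z - k * ?C * sinh z) / (?v\<^sup>2 - k\<^sup>2)"
    using n0(1) by (simp add: eq_divide_eq mult.commute)
  have cc: "cosh z * cos z = - amp / tanh z"
    unfolding cos_sinh[symmetric] using z_pos by (simp add: tanh_def)
  have "ip h mode_trace (\<lambda>y. cosh (?v * y)) = cosh z * ip h (\<lambda>y. cosh (?v * y)) (\<lambda>y. cos (k * y)) + cos z * ip h (\<lambda>y. cosh (?v * y)) (\<lambda>y. cosh (k * y))"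
    unfolding mode_trace_def[abs_def]
    by (subst ip_add_left) (auto intro!: continuous_intros simp: ip_scale_left ip_commute)
  also have "\<dots> = (?v * ?S * (cosh z * cos z) + k * ?C * amp) / (?v\<^sup>2 + k\<^sup>2)
      + (?v * ?S * (cosh z * cos z) - k * ?C * (cos z * sinh z)) / (?v\<^sup>2 - k\<^sup>2)"
    unfolding 1 2 by (simp add: amp_def algebra_simps)
  also have "\<dots> = (?v * ?S * (cosh z * cos z) + k * ?C * amp) * (1 / (?v\<^sup>2 + k\<^sup>2) + 1 / (?v\<^sup>2 - k\<^sup>2))"
    unfolding cos_sinh by (simp add: algebra_simps add_divide_distrib)
  also have "1 / (?v\<^sup>2 + k\<^sup>2) + 1 / (?v\<^sup>2 - k\<^sup>2) = 2 * perron m"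
  proof -
    have "1 / (?v\<^sup>2 + k\<^sup>2) + 1 / (?v\<^sup>2 - k\<^sup>2) = 2 * ?v\<^sup>2 / ((?v\<^sup>2 + k\<^sup>2) * (?v\<^sup>2 - k\<^sup>2))"
      using n0 by (simp add: add_frac_eq)
    also have "(?v\<^sup>2 + k\<^sup>2) * (?v\<^sup>2 - k\<^sup>2) = ?v ^ 4 - k ^ 4" by algebra
    finally show ?thesis unfolding perron_def by simp
  qed
  finally show ?thesis unfolding cc by (simp add: algebra_simps)
qed

text \<open>
Parseval's identity for \<open>mode_trace\<close> against \<open>cosh (\<nu>\<^sub>m y)\<close> evaluates the infinite sum exactly. All its terms
have the same sign, so every partial sum is bounded by the limit.
\<close>

lemma perron_row_sum:
  assumes m: "m \<ge> 1"
  shows "(\<Sum>n=1..N. perron n / ((freq h n)\<^sup>2 + (freq h m)\<^sup>2)) \<le>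
    h / 2 * perron m * (1 / eigval - cosh (freq h m * h) / (freq h m * sinh (freq h m * h)))"
proof -
  let ?v = "freq h m" let ?S = "sinh (freq h m * h)" and ?C = "cosh (freq h m * h)"
  have v: "?v > 0" using freq_pos[OF h m] .
  then have S: "?S > 0" using h by simp
  define t where "t n = ip h mode_trace (cosine h n) * ip h (\<lambda>y. cosh (?v * y)) (cosine h n) / cosine_weight h n" for n
  have t_eq: "- t n = 2 * k * amp * ?v * ?S * (perron n / ((freq h n)\<^sup>2 + ?v\<^sup>2)) / cosine_weight h n" for n
  proof -
    have "((- 1) ^ n * (- 1) ^ n :: real) = 1" by (simp flip: power_mult_distrib)
    then show ?thesis
      unfolding t_def ip_mode_cosine ip_commute[of h "\<lambda>y. cosh (?v * y)"]
      using v by (simp add: ip_cosine_cosh[OF h])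
  qed
  have c: "continuous_on {0..h} mode_trace" "continuous_on {0..h} (\<lambda>y. cosh (?v * y))"
    by (auto intro!: continuous_intros continuous_on_mode)
  have sums: "(\<lambda>n. - t n) sums - ip h mode_trace (\<lambda>y. cosh (?v * y))"
    unfolding t_def by (intro sums_minus parseval_product h c)
  have nonneg: "0 \<le> - t n" for n
  proof (cases "n = 0")
    case True
    then show ?thesis unfolding t_eq by (simp add: perron_0)
  next
    case False
    then show ?thesis unfolding t_eq using perron_pos[of n] k_pos amp_pos v S h
      by (intro divide_nonneg_nonneg mult_nonneg_nonneg) (auto simp: cosine_weight_def)
  qed
  have "4 * k * amp * ?v * ?S / h * (\<Sum>n=1..N. perron n / ((freq h n)\<^sup>2 + ?v\<^sup>2)) = (\<Sum>n=1..N. - t n)"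
    unfolding sum_distrib_left by (intro sum.cong) (auto simp: t_eq cosine_weight_def mult_ac)
  also have "\<dots> \<le> - ip h mode_trace (\<lambda>y. cosh (?v * y))"
    using sum_le_suminf[OF sums_summable[OF sums], of "{1..N}"] nonneg sums_unique[OF sums] by simp
  also have "\<dots> = 4 * k * amp * ?v * ?S / h * (h / 2 * perron m * (1 / eigval - ?C / (?v * ?S)))"
    unfolding ip_mode_cosh[OF m] eigval_eq using k_pos v S h tanh_pos by (simp add: field_simps)
  finally show ?thesis
    using k_pos amp_pos v S h by (subst (asm) mult_le_cancel_left_pos) auto
qed

text \<open>
The Schur test with the vector \<open>perron\<close>: each product is split by the inequality between the arithmetic
and the geometric mean in the ratio of the corresponding entries of \<open>perron\<close>.
\<close>

lemma schur_bound:
  "(\<Sum>m=1..N. \<Sum>n=1..N. \<bar>b m\<bar> * \<bar>b n\<bar> / ((freq h n)\<^sup>2 + (freq h m)\<^sup>2))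
    \<le> (\<Sum>m=1..N. (b m)\<^sup>2 * (h / 2 * (1 / eigval - cosh (freq h m * h) / (freq h m * sinh (freq h m * h)))))"
proof -
  define K where "K m n = 1 / ((freq h n)\<^sup>2 + (freq h m)\<^sup>2)" for m n
  have half: "(A + A) / 2 = A" for A :: real by simp
  have Ksym: "K m n = K n m" for m n by (simp add: K_def add.commute)
  have "\<bar>b m\<bar> * \<bar>b n\<bar> * K m n \<le> ((b m)\<^sup>2 * (perron n / perron m) * K m n + (b n)\<^sup>2 * (perron m / perron n) * K n m) / 2"
    if "m \<in> {1..N}" "n \<in> {1..N}" for m n
  proof -
    have w: "perron m > 0" "perron n > 0" using that perron_pos by auto
    have "0 \<le> (\<bar>b m\<bar> * perron n - \<bar>b n\<bar> * perron m)\<^sup>2 / (perron m * perron n)" using w by simp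
    also have "\<dots> = (b m)\<^sup>2 * (perron n / perron m) + (b n)\<^sup>2 * (perron m / perron n) - 2 * (\<bar>b m\<bar> * \<bar>b n\<bar>)"
      using w by (simp add: power2_diff power_mult_distrib field_simps power2_eq_square)
    finally have "\<bar>b m\<bar> * \<bar>b n\<bar> \<le> ((b m)\<^sup>2 * (perron n / perron m) + (b n)\<^sup>2 * (perron m / perron n)) / 2" by simp
    then have "\<bar>b m\<bar> * \<bar>b n\<bar> * K m n \<le> ((b m)\<^sup>2 * (perron n / perron m) + (b n)\<^sup>2 * (perron m / perron n)) / 2 * K m n"
      by (rule mult_right_mono) (simp add: K_def)
    then show ?thesis by (simp add: Ksym[of n m] algebra_simps)
  qed
  then have "(\<Sum>m=1..N. \<Sum>n=1..N. \<bar>b m\<bar> * \<bar>b n\<bar> * K m n)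
      \<le> (\<Sum>m=1..N. \<Sum>n=1..N. ((b m)\<^sup>2 * (perron n / perron m) * K m n + (b n)\<^sup>2 * (perron m / perron n) * K n m) / 2)"
    by (intro sum_mono)
  also have "\<dots> = ((\<Sum>m=1..N. \<Sum>n=1..N. (b m)\<^sup>2 * (perron n / perron m) * K m n)
      + (\<Sum>m=1..N. \<Sum>n=1..N. (b n)\<^sup>2 * (perron m / perron n) * K n m)) / 2"
    by (simp add: sum.distrib sum_divide_distrib add_divide_distrib)
  also have "(\<Sum>m=1..N. \<Sum>n=1..N. (b n)\<^sup>2 * (perron m / perron n) * K n m)
      = (\<Sum>m=1..N. \<Sum>n=1..N. (b m)\<^sup>2 * (perron n / perron m) * K m n)"
    by (rule sum.swap)
  also have "((\<Sum>m=1..N. \<Sum>n=1..N. (b m)\<^sup>2 * (perron n / perron m) * K m n)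
      + (\<Sum>m=1..N. \<Sum>n=1..N. (b m)\<^sup>2 * (perron n / perron m) * K m n)) / 2
      = (\<Sum>m=1..N. (b m)\<^sup>2 / perron m * (\<Sum>n=1..N. perron n * K m n))"
    unfolding half by (simp add: sum_distrib_left mult_ac)
  also have "\<dots> \<le> (\<Sum>m=1..N. (b m)\<^sup>2 * (h / 2 * (1 / eigval - cosh (freq h m * h) / (freq h m * sinh (freq h m * h)))))"
  proof (rule sum_mono)
    fix m assume m: "m \<in> {1..N}"
    then have w: "perron m > 0" using perron_pos by auto
    have "(b m)\<^sup>2 / perron m * (\<Sum>n=1..N. perron n * K m n) \<le> (b m)\<^sup>2 / perron m *
        (h / 2 * perron m * (1 / eigval - cosh (freq h m * h) / (freq h m * sinh (freq h m * h))))"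
      using perron_row_sum[of m N] m w by (intro mult_left_mono) (auto simp: K_def)
    then show "(b m)\<^sup>2 / perron m * (\<Sum>n=1..N. perron n * K m n) \<le>
        (b m)\<^sup>2 * (h / 2 * (1 / eigval - cosh (freq h m * h) / (freq h m * sinh (freq h m * h))))"
      using w by simp
  qed
  finally show ?thesis by (simp add: K_def)
qed

text \<open>
The left-hand side is the Neumann-to-Dirichlet form of the data \<open>\<Sum>n. b n cos (\<nu>\<^sub>n y)\<close>. The \<open>coth\<close> terms
on its diagonal cancel those in the row sums.
\<close>

lemma steklov_form_bound:
  "(\<Sum>m=1..N. \<Sum>n=1..N. b m * b n / (freq h n * sinh (freq h n * h)) *
      ip h (cosine h m) (\<lambda>y. cosh (freq h n * h) * cosine h n y + (- 1) ^ n * cosh (freq h n * y)))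
    \<le> 1 / eigval * (\<Sum>m=1..N. (b m)\<^sup>2 * (h / 2))"
proof -
  let ?q = "\<lambda>n. freq h n * sinh (freq h n * h)"
  define K where "K m n = 1 / ((freq h m)\<^sup>2 + (freq h n)\<^sup>2)" for m n
  have q: "?q n > 0" if "n \<ge> 1" for n using freq_pos[OF h that] h by simp
  have entry: "b m * b n / ?q n * ip h (cosine h m) (\<lambda>y. cosh (freq h n * h) * cosine h n y + (- 1) ^ n * cosh (freq h n * y))
      = (if m = n then (b m)\<^sup>2 * (h / 2 * (cosh (freq h m * h) / ?q m)) else 0) + (- 1) ^ m * b m * ((- 1) ^ n * b n) * K m n"
    if "m \<in> {1..N}" "n \<in> {1..N}" for m n
  proof -
    have n: "n \<ge> 1" "m \<ge> 1" using that by auto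
    have "ip h (cosine h m) (\<lambda>y. cosh (freq h n * h) * cosine h n y + (- 1) ^ n * cosh (freq h n * y))
        = cosh (freq h n * h) * ip h (cosine h m) (cosine h n) + (- 1) ^ n * ip h (cosine h m) (\<lambda>y. cosh (freq h n * y))"
      unfolding ip_commute[of h "cosine h m"]
      by (subst ip_add_left) (auto intro!: continuous_intros simp: ip_scale_left)
    also have "\<dots> = cosh (freq h n * h) * (if m = n then h / 2 else 0) + (- 1) ^ n * ((- 1) ^ m * ?q n * K m n)"
      using n freq_pos[OF h n(1)] by (simp add: ip_cosine_cosine[OF h] ip_cosine_cosh[OF h] cosine_weight_def K_def)
    finally show ?thesis using q[OF n(1)] freq_pos[OF h n(1)] h by (simp add: algebra_simps power2_eq_square)
  qed
  have "(\<Sum>m=1..N. \<Sum>n=1..N. b m * b n / ?q n *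
      ip h (cosine h m) (\<lambda>y. cosh (freq h n * h) * cosine h n y + (- 1) ^ n * cosh (freq h n * y)))
     = (\<Sum>m=1..N. \<Sum>n=1..N. (if m = n then (b m)\<^sup>2 * (h / 2 * (cosh (freq h m * h) / ?q m)) else 0)
         + (- 1) ^ m * b m * ((- 1) ^ n * b n) * K m n)"
    by (intro sum.cong refl entry)
  also have "\<dots> = (\<Sum>m=1..N. (b m)\<^sup>2 * (h / 2 * (cosh (freq h m * h) / ?q m)))
      + (\<Sum>m=1..N. \<Sum>n=1..N. (- 1) ^ m * b m * ((- 1) ^ n * b n) * K m n)"
    by (simp add: sum.distrib sum.delta)
  also have "(\<Sum>m=1..N. \<Sum>n=1..N. (- 1) ^ m * b m * ((- 1) ^ n * b n) * K m n)
      \<le> (\<Sum>m=1..N. \<Sum>n=1..N. \<bar>b m\<bar> * \<bar>b n\<bar> / ((freq h n)\<^sup>2 + (freq h m)\<^sup>2))"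
  proof (intro sum_mono)
    fix m n
    have "(- 1) ^ m * b m * ((- 1) ^ n * b n) * K m n \<le> \<bar>(- 1) ^ m * b m * ((- 1) ^ n * b n) * K m n\<bar>" by simp
    also have "\<dots> = \<bar>b m\<bar> * \<bar>b n\<bar> / ((freq h n)\<^sup>2 + (freq h m)\<^sup>2)"
      by (simp add: abs_mult power_abs K_def add.commute)
    finally show "(- 1) ^ m * b m * ((- 1) ^ n * b n) * K m n \<le> \<bar>b m\<bar> * \<bar>b n\<bar> / ((freq h n)\<^sup>2 + (freq h m)\<^sup>2)" .
  qed
  also note schur_bound
  finally show ?thesis
    by (simp add: right_diff_distrib sum_subtractf sum_distrib_left mult.left_commute mult.commute[of eigval])
qed

end

section \<open>Green's formula and the inequality for smooth functions\<close>

lemma smooth_differentiable: "smooth f \<Longrightarrow> f differentiable (at x)"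
  unfolding smooth_def using C_k.simps(2)[of 0 f] by blast

lemma smooth_continuous: "smooth f \<Longrightarrow> continuous_on S f"
  unfolding smooth_def by (metis C_k.simps(1) continuous_on_subset subset_UNIV)

lemma smooth_continuous_partial: "smooth f \<Longrightarrow> b \<in> Basis \<Longrightarrow> continuous_on S (partial_deriv b f)"
  unfolding smooth_def by (metis C_k.simps continuous_on_subset subset_UNIV)

lemma grad_inner: "b \<in> Basis \<Longrightarrow> grad f x \<bullet> b = partial_deriv b f x"
  by (simp add: grad_def inner_sum_left_Basis)

lemma continuous_on_grad: "smooth f \<Longrightarrow> continuous_on S (grad f)"
  unfolding grad_def[abs_def] by (intro continuous_intros smooth_continuous_partial)

lemma grad_nth: "grad f x $ i = partial_deriv (axis i 1) f x" for f :: "real^2 \<Rightarrow> real"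
  by (simp add: cart_eq_inner_axis grad_inner axis_in_Basis_iff)

lemma inner_2: "x \<bullet> y = x $ 1 * y $ 1 + x $ 2 * y $ 2" for x y :: "real^2"
  by (simp add: inner_vec_def sum_2)

lemma vector_2_eta [simp]: "vector [v $ 1, v $ 2] = v" for v :: "real^2"
  by (simp add: vec_eq_iff forall_2)

lemma vector_2_eq: "vector [x, y] = x *\<^sub>R axis 1 1 + y *\<^sub>R (axis 2 1 :: real^2)"
  by (simp add: vec_eq_iff forall_2 axis_def)

lemma partial_deriv_scaleR:
  assumes "smooth f"
  shows "partial_deriv (t *\<^sub>R b) f v = partial_deriv b f v * t"
proof -
  have "linear (\<lambda>b. partial_deriv b f v)"
    by (rule has_derivative_linear[OF has_derivative_frechet[OF smooth_differentiable[OF assms]]])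
  from linear_scale[OF this, of t b] show ?thesis by simp
qed

lemma smooth_DERIV_fst:
  assumes "smooth f"
  shows "((\<lambda>x. f (vector [x, y] :: real^2)) has_real_derivative grad f (vector [x, y]) $ 1) (at x)"
proof -
  have "((\<lambda>x. vector [x, y] :: real^2) has_derivative (\<lambda>t. t *\<^sub>R axis 1 1)) (at x)"
    unfolding vector_2_eq by (auto intro!: derivative_eq_intros)
  from has_derivative_compose[OF this has_derivative_frechet[OF smooth_differentiable[OF assms]]]
  have d: "((\<lambda>x. f (vector [x, y] :: real^2)) has_derivative (\<lambda>t. partial_deriv (t *\<^sub>R axis 1 1) f (vector [x, y]))) (at x)" .
  then show ?thesis
    by (simp add: has_field_derivative_def grad_nth partial_deriv_scaleR[OF assms])
qed

lemma smooth_DERIV_snd: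
  assumes "smooth f"
  shows "((\<lambda>y. f (vector [x, y] :: real^2)) has_real_derivative grad f (vector [x, y]) $ 2) (at y)"
proof -
  have "((\<lambda>y. vector [x, y] :: real^2) has_derivative (\<lambda>t. t *\<^sub>R axis 2 1)) (at y)"
    unfolding vector_2_eq by (auto intro!: derivative_eq_intros)
  from has_derivative_compose[OF this has_derivative_frechet[OF smooth_differentiable[OF assms]]]
  have d: "((\<lambda>y. f (vector [x, y] :: real^2)) has_derivative (\<lambda>t. partial_deriv (t *\<^sub>R axis 2 1) f (vector [x, y]))) (at y)" .
  then show ?thesis
    by (simp add: has_field_derivative_def grad_nth partial_deriv_scaleR[OF assms])
qed

lemma continuous_on_vector_compose:
  "continuous_on UNIV (f :: real^2 \<Rightarrow> 'b::topological_space) \<Longrightarrow> continuous_on UNIV g \<Longrightarrow> continuous_on UNIV k \<Longrightarrow>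
    continuous_on UNIV (\<lambda>y::real. f (vector [g y, k y]))"
  by (rule continuous_on_compose2[of UNIV f]) (auto intro: continuous_intros)

text \<open>
The divergence theorem for \<open>\<psi>\<close> times the field \<open>(p, q)\<close>. The field is tangential to the bottom side and to
the diagonal, so only the leg contributes.
\<close>

lemma green_triangle:
  fixes \<psi> :: "real^2 \<Rightarrow> real" and p q p' q' :: "real \<Rightarrow> real \<Rightarrow> real"
  assumes \<psi>: "smooth \<psi>"
    and p: "\<And>x y. ((\<lambda>x. p x y) has_real_derivative p' x y) (at x)"
    and q: "\<And>x y. ((\<lambda>y. q x y) has_real_derivative q' x y) (at y)"
    and cont: "continuous_on UNIV (\<lambda>v::real^2. p (v $ 1) (v $ 2))" "continuous_on UNIV (\<lambda>v::real^2. q (v $ 1) (v $ 2))"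
      "continuous_on UNIV (\<lambda>v::real^2. p' (v $ 1) (v $ 2))" "continuous_on UNIV (\<lambda>v::real^2. q' (v $ 1) (v $ 2))"
    and bottom: "\<And>x. q x 0 = 0" and diagonal: "\<And>x. p x x = q x x"
  shows "integral\<^sup>L (lebesgue_on (triangle h)) (\<lambda>v. \<psi> v * (p' (v $ 1) (v $ 2) + q' (v $ 1) (v $ 2))
      + grad \<psi> v \<bullet> vector [p (v $ 1) (v $ 2), q (v $ 1) (v $ 2)])
    = integral {0..h} (\<lambda>y. p h y * \<psi> (leg_map h y))"
proof -
  note c = smooth_continuous[OF \<psi>] continuous_on_grad[OF \<psi>] cont
  have diag: "continuous_on UNIV (\<lambda>y. f y y)" and side: "continuous_on UNIV (\<lambda>y. f h y)"
    if "continuous_on UNIV (\<lambda>v::real^2. f (v $ 1) (v $ 2))" for f :: "real \<Rightarrow> real \<Rightarrow> real"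
    using continuous_on_vector_compose[OF that continuous_on_id continuous_on_id]
      continuous_on_vector_compose[OF that continuous_on_const[of UNIV h] continuous_on_id] by simp_all
  let ?\<psi> = "\<lambda>x y. \<psi> (vector [x, y])"
  let ?F = "\<lambda>x y. grad \<psi> (vector [x, y]) $ 1 * p x y + p' x y * \<psi> (vector [x, y])"
  let ?G = "\<lambda>x y. grad \<psi> (vector [x, y]) $ 2 * q x y + q' x y * \<psi> (vector [x, y])"
  have cF: "continuous_on UNIV (\<lambda>v::real^2. ?F (v $ 1) (v $ 2))" "continuous_on UNIV (\<lambda>v::real^2. ?G (v $ 1) (v $ 2))"
    unfolding vector_2_eta by (intro continuous_intros c)+
  have cs: "continuous_on UNIV (\<lambda>y. \<psi> (vector [h, y]) * p h y)" "continuous_on UNIV (\<lambda>y. \<psi> (vector [y, y]) * p y y)"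
    by (intro continuous_intros continuous_on_vector_compose c diag side)+
  have 1: "integral\<^sup>L (lebesgue_on (triangle h)) (\<lambda>v. ?F (v $ 1) (v $ 2))
      = integral {0..h} (\<lambda>y. ?\<psi> h y * p h y - ?\<psi> y y * p y y)"
  proof (rule integral_triangle_dx[OF cF(1)])
    show "((\<lambda>x. ?\<psi> x y * p x y) has_real_derivative ?F x y) (at x)" for x y
      by (rule DERIV_mult[OF smooth_DERIV_fst[OF \<psi>] p])
  qed (intro continuous_intros cs)
  have 2: "integral\<^sup>L (lebesgue_on (triangle h)) (\<lambda>v. ?G (v $ 1) (v $ 2))
      = integral {0..h} (\<lambda>x. ?\<psi> x x * q x x - ?\<psi> x 0 * q x 0)"
  proof (rule integral_triangle_dy[OF cF(2)])
    show "((\<lambda>y. ?\<psi> x y * q x y) has_real_derivative ?G x y) (at y)" for x y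
      by (rule DERIV_mult[OF smooth_DERIV_snd[OF \<psi>] q])
    show "continuous_on UNIV (\<lambda>x. ?\<psi> x x * q x x - ?\<psi> x 0 * q x 0)"
      using cs(2) by (simp add: bottom diagonal)
  qed
  have "integral\<^sup>L (lebesgue_on (triangle h)) (\<lambda>v. \<psi> v * (p' (v $ 1) (v $ 2) + q' (v $ 1) (v $ 2))
      + grad \<psi> v \<bullet> vector [p (v $ 1) (v $ 2), q (v $ 1) (v $ 2)])
      = integral\<^sup>L (lebesgue_on (triangle h)) (\<lambda>v. ?F (v $ 1) (v $ 2) + ?G (v $ 1) (v $ 2))"
    by (intro Bochner_Integration.integral_cong refl) (simp add: inner_2 algebra_simps)
  also have "\<dots> = integral {0..h} (\<lambda>y. ?\<psi> h y * p h y - ?\<psi> y y * p y y) + integral {0..h} (\<lambda>x. ?\<psi> x x * q x x - ?\<psi> x 0 * q x 0)"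
    unfolding 1[symmetric] 2[symmetric] by (intro Bochner_Integration.integral_add integrable_triangle cF)
  also have "\<dots> = integral {0..h} (\<lambda>y. ?\<psi> h y * p h y - ?\<psi> y y * p y y + ?\<psi> y y * p y y)"
    unfolding bottom diagonal[symmetric] mult_zero_right diff_zero
    by (intro Henstock_Kurzweil_Integration.integral_add[symmetric] integrable_continuous_real continuous_intros continuous_on_subset[OF cs(1)] continuous_on_subset[OF cs(2)]) auto
  finally show ?thesis by (simp add: leg_map_def mult.commute)
qed

lemma green_position:
  assumes "smooth \<psi>"
  shows "integral\<^sup>L (lebesgue_on (triangle h)) (\<lambda>v. 2 * \<psi> v + grad \<psi> v \<bullet> v) = h * integral {0..h} (\<lambda>y. \<psi> (leg_map h y))"
  using green_triangle[OF assms, of "\<lambda>x y. x" "\<lambda>x y. 1" "\<lambda>x y. y" "\<lambda>x y. 1" h]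
  by (simp add: continuous_intros mult.commute)

text \<open>
Harmonic for every \<open>\<kappa>\<close>, even in both coordinates and symmetric under exchanging them.
\<close>

definition harmonic_mode :: "real \<Rightarrow> real^2 \<Rightarrow> real" where
  "harmonic_mode \<kappa> v = cosh (\<kappa> * v $ 1) * cos (\<kappa> * v $ 2) + cos (\<kappa> * v $ 1) * cosh (\<kappa> * v $ 2)"

definition harmonic_mode_dx :: "real \<Rightarrow> real \<Rightarrow> real \<Rightarrow> real" where
  "harmonic_mode_dx \<kappa> x y = \<kappa> * sinh (\<kappa> * x) * cos (\<kappa> * y) - \<kappa> * sin (\<kappa> * x) * cosh (\<kappa> * y)"

definition harmonic_mode_dy :: "real \<Rightarrow> real \<Rightarrow> real \<Rightarrow> real" where
  "harmonic_mode_dy \<kappa> x y = \<kappa> * cos (\<kappa> * x) * sinh (\<kappa> * y) - \<kappa> * cosh (\<kappa> * x) * sin (\<kappa> * y)"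

lemma smooth_cos: "smooth (\<lambda>v::real^2. cos (\<kappa> * v $ i))"
proof -
  have "deriv_chain (\<lambda>n x. cos (x + real n * pi / 2))"
    unfolding deriv_chain_def
  proof (intro allI)
    fix n x
    have "cos (x + real (Suc n) * pi / 2) = - sin (x + real n * pi / 2)"
      using cos_add[of "x + real n * pi / 2" "pi / 2"] by (simp add: field_simps)
    then show "((\<lambda>x. cos (x + real n * pi / 2)) has_real_derivative cos (x + real (Suc n) * pi / 2)) (at x)"
      by (auto intro!: derivative_eq_intros)
  qed
  from smooth_ridge[OF deriv_chain_affine[OF this, of \<kappa> 0], of "axis i 1"] show ?thesis
    by (simp add: cart_eq_inner_axis)
qed

lemma smooth_cosh: "smooth (\<lambda>v::real^2. cosh (\<kappa> * v $ i))"
proof -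
  have "deriv_chain (\<lambda>n x. if even n then cosh x else sinh x)"
    unfolding deriv_chain_def by (auto intro!: derivative_eq_intros)
  from smooth_ridge[OF deriv_chain_affine[OF this, of \<kappa> 0], of "axis i 1"] show ?thesis
    by (simp add: cart_eq_inner_axis)
qed

lemma smooth_harmonic_mode: "smooth (harmonic_mode \<kappa>)"
  unfolding harmonic_mode_def[abs_def] by (intro smooth_add smooth_mult smooth_cos smooth_cosh)

lemma grad_harmonic_mode: "grad (harmonic_mode \<kappa>) v = vector [harmonic_mode_dx \<kappa> (v $ 1) (v $ 2), harmonic_mode_dy \<kappa> (v $ 1) (v $ 2)]"
proof -
  have "((\<lambda>x. harmonic_mode \<kappa> (vector [x, v $ 2])) has_real_derivative harmonic_mode_dx \<kappa> (v $ 1) (v $ 2)) (at (v $ 1))"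
    by (auto simp: harmonic_mode_def harmonic_mode_dx_def intro!: derivative_eq_intros)
  then have "grad (harmonic_mode \<kappa>) v $ 1 = harmonic_mode_dx \<kappa> (v $ 1) (v $ 2)"
    using smooth_DERIV_fst[OF smooth_harmonic_mode, of \<kappa> "v $ 2" "v $ 1"] DERIV_unique by fastforce
  moreover have "((\<lambda>y. harmonic_mode \<kappa> (vector [v $ 1, y])) has_real_derivative harmonic_mode_dy \<kappa> (v $ 1) (v $ 2)) (at (v $ 2))"
    by (auto simp: harmonic_mode_def harmonic_mode_dy_def intro!: derivative_eq_intros)
  then have "grad (harmonic_mode \<kappa>) v $ 2 = harmonic_mode_dy \<kappa> (v $ 1) (v $ 2)"
    using smooth_DERIV_snd[OF smooth_harmonic_mode, of \<kappa> "v $ 1" "v $ 2"] DERIV_unique by fastforce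
  ultimately show ?thesis by (simp add: vec_eq_iff forall_2)
qed

lemma green_harmonic_mode:
  assumes "smooth \<psi>"
  shows "integral\<^sup>L (lebesgue_on (triangle h)) (\<lambda>v. grad \<psi> v \<bullet> grad (harmonic_mode \<kappa>) v) = integral {0..h} (\<lambda>y. harmonic_mode_dx \<kappa> h y * \<psi> (leg_map h y))"
proof -
  let ?D = "\<lambda>x y. \<kappa>\<^sup>2 * (cosh (\<kappa> * x) * cos (\<kappa> * y) - cos (\<kappa> * x) * cosh (\<kappa> * y))"
  have "integral\<^sup>L (lebesgue_on (triangle h)) (\<lambda>v. \<psi> v * (?D (v $ 1) (v $ 2) + - ?D (v $ 1) (v $ 2))
      + grad \<psi> v \<bullet> vector [harmonic_mode_dx \<kappa> (v $ 1) (v $ 2), harmonic_mode_dy \<kappa> (v $ 1) (v $ 2)])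
    = integral {0..h} (\<lambda>y. harmonic_mode_dx \<kappa> h y * \<psi> (leg_map h y))"
  proof (rule green_triangle[OF assms])
    show "((\<lambda>x. harmonic_mode_dx \<kappa> x y) has_real_derivative ?D x y) (at x)" for x y
      unfolding harmonic_mode_dx_def by (auto intro!: derivative_eq_intros simp: algebra_simps power2_eq_square)
    show "((\<lambda>y. harmonic_mode_dy \<kappa> x y) has_real_derivative - ?D x y) (at y)" for x y
      unfolding harmonic_mode_dy_def by (auto intro!: derivative_eq_intros simp: algebra_simps power2_eq_square)
  qed (auto simp: harmonic_mode_dx_def harmonic_mode_dy_def intro!: continuous_intros)
  then show ?thesis by (simp add: grad_harmonic_mode)
qed

context leg_mode begin

lemma harmonic_mode_leg: "harmonic_mode (freq h n) (leg_map h y) = cosh (freq h n * h) * cosine h n y + (- 1) ^ n * cosh (freq h n * y)"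
  using h by (simp add: harmonic_mode_def cosine_def cos_freq)

lemma green_harmonic_mode_freq:
  assumes "smooth \<psi>"
  shows "integral\<^sup>L (lebesgue_on (triangle h)) (\<lambda>v. grad \<psi> v \<bullet> grad (harmonic_mode (freq h n)) v)
    = freq h n * sinh (freq h n * h) * ip h (cosine h n) (\<lambda>y. \<psi> (leg_map h y))"
proof -
  have "sin (freq h n * h) = 0" using h by (simp add: sin_freq)
  then have "harmonic_mode_dx (freq h n) h y = freq h n * sinh (freq h n * h) * cosine h n y" for y
    by (simp add: harmonic_mode_dx_def cosine_def)
  then show ?thesis unfolding green_harmonic_mode[OF assms] by (simp add: ip_def mult.assoc)
qed

text \<open>
The gradient of the harmonic function with normal derivative \<open>\<Sum>n = 1..N. b n cos (\<nu>\<^sub>n y)\<close> on the leg and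
zero on the other sides.
\<close>

definition trial_field :: "(nat \<Rightarrow> real) \<Rightarrow> nat \<Rightarrow> real^2 \<Rightarrow> real^2" where
  "trial_field b N v = (\<Sum>n=1..N. (b n / (freq h n * sinh (freq h n * h))) *\<^sub>R grad (harmonic_mode (freq h n)) v)"

lemma continuous_on_trial_field: "continuous_on S (trial_field b N)"
  unfolding trial_field_def[abs_def] by (intro continuous_intros continuous_on_grad smooth_harmonic_mode)

lemma integral_grad_trial_field:
  assumes "smooth \<psi>"
  shows "integral\<^sup>L (lebesgue_on (triangle h)) (\<lambda>v. grad \<psi> v \<bullet> trial_field b N v) = (\<Sum>n=1..N. b n * ip h (cosine h n) (\<lambda>y. \<psi> (leg_map h y)))"
proof -
  have "integral\<^sup>L (lebesgue_on (triangle h)) (\<lambda>v. grad \<psi> v \<bullet> trial_field b N v)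
     = integral\<^sup>L (lebesgue_on (triangle h)) (\<lambda>v. \<Sum>n=1..N. b n / (freq h n * sinh (freq h n * h)) * (grad \<psi> v \<bullet> grad (harmonic_mode (freq h n)) v))"
    by (simp add: trial_field_def inner_sum_right)
  also have "\<dots> = (\<Sum>n=1..N. b n / (freq h n * sinh (freq h n * h)) * integral\<^sup>L (lebesgue_on (triangle h)) (\<lambda>v. grad \<psi> v \<bullet> grad (harmonic_mode (freq h n)) v))"
    by (subst Bochner_Integration.integral_sum)
       (auto intro!: integrable_mult_right integrable_triangle continuous_on_inner continuous_on_grad smooth_harmonic_mode assms simp del: times_divide_eq_left)
  also have "\<dots> = (\<Sum>n=1..N. b n * ip h (cosine h n) (\<lambda>y. \<psi> (leg_map h y)))"
  proof (intro sum.cong refl)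
    fix n assume "n \<in> {1..N}"
    then have "freq h n > 0" using freq_pos[OF h] by auto
    then have "freq h n * sinh (freq h n * h) \<noteq> 0" using h by simp
    then show "b n / (freq h n * sinh (freq h n * h)) * integral\<^sup>L (lebesgue_on (triangle h)) (\<lambda>v. grad \<psi> v \<bullet> grad (harmonic_mode (freq h n)) v)
        = b n * ip h (cosine h n) (\<lambda>y. \<psi> (leg_map h y))"
      unfolding green_harmonic_mode_freq[OF assms] by simp
  qed
  finally show ?thesis .
qed

text \<open>
By Green's formula the energy is the Neumann-to-Dirichlet form of the boundary data.
\<close>

lemma trial_energy:
  "integral\<^sup>L (lebesgue_on (triangle h)) (\<lambda>v. trial_field b N v \<bullet> trial_field b N v) \<le> 1 / eigval * (\<Sum>m=1..N. (b m)\<^sup>2 * (h / 2))"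
proof -
  have "integral\<^sup>L (lebesgue_on (triangle h)) (\<lambda>v. trial_field b N v \<bullet> trial_field b N v)
     = integral\<^sup>L (lebesgue_on (triangle h)) (\<lambda>v. \<Sum>n=1..N. b n / (freq h n * sinh (freq h n * h)) * (grad (harmonic_mode (freq h n)) v \<bullet> trial_field b N v))"
    unfolding trial_field_def[of b N] by (subst inner_sum_left) simp
  also have "\<dots> = (\<Sum>n=1..N. b n / (freq h n * sinh (freq h n * h)) * integral\<^sup>L (lebesgue_on (triangle h)) (\<lambda>v. grad (harmonic_mode (freq h n)) v \<bullet> trial_field b N v))"
    by (subst Bochner_Integration.integral_sum)
       (auto intro!: integrable_mult_right integrable_triangle continuous_on_inner continuous_on_grad smooth_harmonic_mode continuous_on_trial_field simp del: times_divide_eq_left)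
  also have "\<dots> = (\<Sum>n=1..N. \<Sum>m=1..N. b m * b n / (freq h n * sinh (freq h n * h)) *
      ip h (cosine h m) (\<lambda>y. cosh (freq h n * h) * cosine h n y + (- 1) ^ n * cosh (freq h n * y)))"
    unfolding integral_grad_trial_field[OF smooth_harmonic_mode] harmonic_mode_leg sum_distrib_left by (simp add: mult_ac)
  also have "\<dots> = (\<Sum>m=1..N. \<Sum>n=1..N. b m * b n / (freq h n * sinh (freq h n * h)) *
      ip h (cosine h m) (\<lambda>y. cosh (freq h n * h) * cosine h n y + (- 1) ^ n * cosh (freq h n * y)))"
    by (rule sum.swap)
  also note steklov_form_bound
  finally show ?thesis .
qed

text \<open>
Expanding \<open>0 \<le> \<integral> (norm (\<nabla>\<phi> - eigval W))\<^sup>2\<close>, where \<open>W\<close> is the trial field of the cosine partial sum of the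
trace, bounds the sum of the squared coefficients with \<open>n \<ge> 1\<close>. Parseval's identity turns it into the norm of
the trace minus its mean.
\<close>

lemma smooth_trace_inequality:
  assumes \<phi>: "smooth \<phi>"
  shows "eigval * (ip h (\<lambda>y. \<phi> (leg_map h y)) (\<lambda>y. \<phi> (leg_map h y)) - (integral {0..h} (\<lambda>y. \<phi> (leg_map h y)))\<^sup>2 / h)
    \<le> integral\<^sup>L (lebesgue_on (triangle h)) (\<lambda>v. (norm (grad \<phi> v))\<^sup>2)"
proof -
  define g where "g y = \<phi> (leg_map h y)" for y
  define a where "a n = ip h g (cosine h n)" for n
  define D where "D = integral\<^sup>L (lebesgue_on (triangle h)) (\<lambda>v. grad \<phi> v \<bullet> grad \<phi> v)"
  have cg: "continuous_on {0..h} g"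
    unfolding g_def by (rule continuous_on_compose2[OF smooth_continuous[OF \<phi>, of UNIV]]) (auto intro: continuous_intros)
  have part: "eigval * (\<Sum>n=1..N. (a n)\<^sup>2 / (h / 2)) \<le> D" for N
  proof -
    \<comment> \<open>The cosine coefficients of \<open>g\<close>: the factor is the reciprocal of the squared norm of a cosine.\<close>
    define b where "b n = 2 / h * a n" for n
    define s where "s = (\<Sum>n=1..N. (a n)\<^sup>2 / (h / 2))"
    let ?W = "trial_field b N"
    have i: "integrable (lebesgue_on (triangle h)) (\<lambda>v. grad \<phi> v \<bullet> grad \<phi> v)" "integrable (lebesgue_on (triangle h)) (\<lambda>v. grad \<phi> v \<bullet> ?W v)"
      "integrable (lebesgue_on (triangle h)) (\<lambda>v. ?W v \<bullet> ?W v)"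
      by (intro integrable_triangle continuous_intros continuous_on_grad \<phi> continuous_on_trial_field)+
    have "0 \<le> integral\<^sup>L (lebesgue_on (triangle h)) (\<lambda>v. (grad \<phi> v - eigval *\<^sub>R ?W v) \<bullet> (grad \<phi> v - eigval *\<^sub>R ?W v))"
      by (rule Bochner_Integration.integral_nonneg) simp
    also have "\<dots> = integral\<^sup>L (lebesgue_on (triangle h)) (\<lambda>v. grad \<phi> v \<bullet> grad \<phi> v - (2 * eigval) * (grad \<phi> v \<bullet> ?W v) + eigval\<^sup>2 * (?W v \<bullet> ?W v))"
      by (intro Bochner_Integration.integral_cong refl)
         (simp add: inner_diff_left inner_diff_right inner_commute power2_eq_square algebra_simps)
    also have "\<dots> = D - 2 * eigval * integral\<^sup>L (lebesgue_on (triangle h)) (\<lambda>v. grad \<phi> v \<bullet> ?W v) + eigval\<^sup>2 * integral\<^sup>L (lebesgue_on (triangle h)) (\<lambda>v. ?W v \<bullet> ?W v)"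
      using i by (simp add: D_def)
    also have "integral\<^sup>L (lebesgue_on (triangle h)) (\<lambda>v. grad \<phi> v \<bullet> ?W v) = s"
      unfolding integral_grad_trial_field[OF \<phi>] s_def g_def[symmetric]
      by (intro sum.cong refl) (simp add: b_def a_def ip_commute[of h _ g] power2_eq_square)
    also have "eigval\<^sup>2 * integral\<^sup>L (lebesgue_on (triangle h)) (\<lambda>v. ?W v \<bullet> ?W v) \<le> eigval\<^sup>2 * (1 / eigval * (\<Sum>m=1..N. (b m)\<^sup>2 * (h / 2)))"
      by (intro mult_left_mono trial_energy) simp
    also have "(\<Sum>m=1..N. (b m)\<^sup>2 * (h / 2)) = s"
      unfolding s_def using h by (intro sum.cong refl) (simp add: b_def power_mult_distrib power_divide power2_eq_square)
    also have "eigval\<^sup>2 * (1 / eigval * s) = eigval * s" using eigval_pos by (simp add: power2_eq_square)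
    finally show ?thesis unfolding s_def[symmetric] by (simp add: mult.commute)
  qed
  have lim: "(\<lambda>N. eigval * ((\<Sum>n\<le>N. (a n)\<^sup>2 / cosine_weight h n) - (a 0)\<^sup>2 / h)) \<longlonglongrightarrow> eigval * (ip h g g - (a 0)\<^sup>2 / h)"
    using parseval[OF h cg] unfolding sums_def_le a_def by (intro tendsto_intros)
  have "eigval * ((\<Sum>n\<le>N. (a n)\<^sup>2 / cosine_weight h n) - (a 0)\<^sup>2 / h) \<le> D" for N
  proof -
    have "{..N} = insert 0 {1..N}" by auto
    then have "(\<Sum>n\<le>N. (a n)\<^sup>2 / cosine_weight h n) - (a 0)\<^sup>2 / h = (\<Sum>n=1..N. (a n)\<^sup>2 / (h / 2))"
      by (simp add: cosine_weight_def)
    then show ?thesis using part by simp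
  qed
  then have "eigval * (ip h g g - (a 0)\<^sup>2 / h) \<le> D"
    by (intro LIMSEQ_le_const2[OF lim] exI[of _ 0]) simp
  moreover have "a 0 = integral {0..h} g" by (simp add: a_def ip_def cosine_def freq_def)
  ultimately show ?thesis by (simp add: D_def g_def[abs_def] power2_norm_eq_inner)
qed

lemma harmonic_mode_k_leg: "harmonic_mode k (leg_map h y) = mode_trace y"
  by (simp add: harmonic_mode_def mode_trace_def kh)

text \<open>
The Steklov condition: the left-hand side is the normal derivative of the extremal function on the leg.
\<close>

lemma mode_flux: "harmonic_mode_dx k h y = eigval * mode_trace y"
proof -
  have "sin z = - (tanh z * cos z)" using root z_pos by (simp add: tanh_def field_simps)
  moreover have "sinh z = tanh z * cosh z" by (simp add: tanh_def)
  ultimately have "harmonic_mode_dx k h y = k * (tanh z * cosh z) * cos (k * y) + k * (tanh z * cos z) * cosh (k * y)"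
    unfolding harmonic_mode_dx_def kh by simp
  then show ?thesis by (simp add: eigval_eq mode_trace_def algebra_simps)
qed

lemma mode_energy: "integral\<^sup>L (lebesgue_on (triangle h)) (\<lambda>v. (norm (grad (harmonic_mode k) v))\<^sup>2) = eigval * ip h mode_trace mode_trace"
  using green_harmonic_mode[OF smooth_harmonic_mode, of h k k] by (simp add: mode_flux harmonic_mode_k_leg ip_def power2_norm_eq_inner mult.assoc)

lemma mode_mean: "integral {0..h} mode_trace = 0"
  using ip_mode_cosine[of 0] by (simp add: ip_def cosine_def freq_def perron_0)

lemma mode_norm_pos: "ip h mode_trace mode_trace > 0"
proof -
  have "(\<Sum>n\<le>1. (ip h mode_trace (cosine h n))\<^sup>2 / cosine_weight h n) \<le> ip h mode_trace mode_trace"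
    using sum_le_suminf[OF sums_summable[OF parseval[OF h continuous_on_mode]], of "{..1}"]
      sums_unique[OF parseval[OF h continuous_on_mode]] h by (simp add: cosine_weight_def)
  moreover have "(ip h mode_trace (cosine h 1))\<^sup>2 / cosine_weight h 1 > 0"
    using perron_pos[of 1] k_pos amp_pos h by (simp add: ip_mode_cosine cosine_weight_def)
  moreover have "(ip h mode_trace (cosine h 0))\<^sup>2 / cosine_weight h 0 = 0" by (simp add: ip_mode_cosine perron_0)
  ultimately show ?thesis by simp
qed

end

section \<open>Passage to the Sobolev space\<close>

lemma integrable_inner_L2:
  assumes "f \<in> L2 M" "g \<in> L2 M" shows "integrable M (\<lambda>x. f x \<bullet> g x)"
proof (rule Bochner_Integration.integrable_bound)
  show "integrable M (\<lambda>x. (norm (f x))\<^sup>2 + (norm (g x))\<^sup>2)" using assms by (simp add: L2_def)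
  show "(\<lambda>x. f x \<bullet> g x) \<in> borel_measurable M" using assms by (auto simp: L2_def)
  have "\<bar>a \<bullet> b\<bar> \<le> (norm a)\<^sup>2 + (norm b)\<^sup>2" for a b :: 'b
  proof -
    have "0 \<le> (norm a - norm b)\<^sup>2" by simp
    then have "2 * (norm a * norm b) \<le> (norm a)\<^sup>2 + (norm b)\<^sup>2" by (simp add: power2_diff)
    moreover have "0 \<le> norm a * norm b" by simp
    ultimately show ?thesis using Cauchy_Schwarz_ineq2[of a b] by linarith
  qed
  then show "AE x in M. norm (f x \<bullet> g x) \<le> norm ((norm (f x))\<^sup>2 + (norm (g x))\<^sup>2)" by simp
qed

lemma norm_diff_scaleR_power2:
  "(norm (a - c *\<^sub>R b))\<^sup>2 = a \<bullet> a - 2 * c * (a \<bullet> b) + c\<^sup>2 * (b \<bullet> b)" for a b :: "'a::real_inner"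
  unfolding power2_norm_eq_inner
  by (simp add: inner_diff_left inner_diff_right inner_commute power2_eq_square algebra_simps)

lemma L2_diff_scale:
  assumes "f \<in> L2 M" "g \<in> L2 M" shows "(\<lambda>x. f x - c *\<^sub>R g x) \<in> L2 M"
proof -
  have "integrable M (\<lambda>x. f x \<bullet> f x - 2 * c * (f x \<bullet> g x) + c\<^sup>2 * (g x \<bullet> g x))"
    using assms by (intro Bochner_Integration.integrable_add Bochner_Integration.integrable_diff integrable_mult_right integrable_inner_L2)
  moreover have "(norm (f x - c *\<^sub>R g x))\<^sup>2 = f x \<bullet> f x - 2 * c * (f x \<bullet> g x) + c\<^sup>2 * (g x \<bullet> g x)" for x
    by (rule norm_diff_scaleR_power2)
  ultimately show ?thesis
    using assms by (auto simp: L2_def intro!: borel_measurable_diff borel_measurable_scaleR)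
qed

lemma L2_diff: "f \<in> L2 M \<Longrightarrow> g \<in> L2 M \<Longrightarrow> (\<lambda>x. f x - g x) \<in> L2 M"
  using L2_diff_scale[of f M g 1] by simp

lemma L2_norm_nonneg: "0 \<le> L2_norm M f"
  by (simp add: L2_norm_def)

lemma L2_norm_power2: "(L2_norm M f)\<^sup>2 = integral\<^sup>L M (\<lambda>x. (norm (f x))\<^sup>2)"
  by (simp add: L2_norm_def)

text \<open>
By the discriminant of the nonnegative quadratic \<open>t \<mapsto> \<parallel>f - t g\<parallel>\<^sup>2\<close>.
\<close>

lemma L2_Cauchy_Schwarz:
  assumes f: "f \<in> L2 M" and g: "g \<in> L2 M"
  shows "\<bar>integral\<^sup>L M (\<lambda>x. f x \<bullet> g x)\<bar> \<le> L2_norm M f * L2_norm M g"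
proof -
  define A B C where "A = (L2_norm M f)\<^sup>2" and "B = integral\<^sup>L M (\<lambda>x. f x \<bullet> g x)" and "C = (L2_norm M g)\<^sup>2"
  have quad: "0 \<le> A - 2 * t * B + t\<^sup>2 * C" for t
  proof -
    have "0 \<le> integral\<^sup>L M (\<lambda>x. (norm (f x - t *\<^sub>R g x))\<^sup>2)"
      by (rule Bochner_Integration.integral_nonneg) simp
    also have "\<dots> = integral\<^sup>L M (\<lambda>x. f x \<bullet> f x - 2 * t * (f x \<bullet> g x) + t\<^sup>2 * (g x \<bullet> g x))"
      by (simp add: norm_diff_scaleR_power2)
    also have "\<dots> = A - 2 * t * B + t\<^sup>2 * C"
      using integrable_inner_L2[OF f f] integrable_inner_L2[OF f g] integrable_inner_L2[OF g g]
      by (simp add: A_def B_def C_def L2_norm_power2 power2_norm_eq_inner)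
    finally show ?thesis .
  qed
  have "B\<^sup>2 \<le> A * C"
  proof (cases "C = 0")
    case True
    \<comment> \<open>This value of \<open>t\<close> would make the linear function equal to \<open>- 1\<close>, unless \<open>B = 0\<close>.\<close>
    then have "0 \<le> A - 2 * ((A + 1) / (2 * B)) * B" using quad[of "(A + 1) / (2 * B)"] by simp
    then have "B = 0" by (cases "B = 0") auto
    then show ?thesis using True by simp
  next
    case False
    then have "C > 0" by (simp add: C_def)
    have "0 \<le> A - 2 * (B / C) * B + (B / C)\<^sup>2 * C" by (rule quad)
    also have "\<dots> = (A * C - B\<^sup>2) / C" using \<open>C > 0\<close> by (simp add: field_simps power2_eq_square)
    finally show ?thesis using \<open>C > 0\<close> by (simp add: zero_le_divide_iff)
  qed
  then have "\<bar>B\<bar>\<^sup>2 \<le> (L2_norm M f * L2_norm M g)\<^sup>2" by (simp add: A_def C_def power_mult_distrib)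
  then show ?thesis unfolding B_def by (rule power2_le_imp_le) (simp add: L2_norm_nonneg)
qed

lemma L2_norm_triangle:
  assumes f: "f \<in> L2 M" and g: "g \<in> L2 M"
  shows "L2_norm M f \<le> L2_norm M (\<lambda>x. f x - g x) + L2_norm M g"
proof -
  define r where "r x = f x - g x" for x
  have r: "r \<in> L2 M" unfolding r_def using f g by (rule L2_diff)
  have "(L2_norm M f)\<^sup>2 = integral\<^sup>L M (\<lambda>x. r x \<bullet> r x + 2 * (r x \<bullet> g x) + g x \<bullet> g x)"
    unfolding L2_norm_power2
    by (intro Bochner_Integration.integral_cong refl)
       (simp add: r_def power2_norm_eq_inner inner_diff_left inner_diff_right inner_commute)
  also have "\<dots> = (L2_norm M r)\<^sup>2 + 2 * integral\<^sup>L M (\<lambda>x. r x \<bullet> g x) + (L2_norm M g)\<^sup>2"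
    using integrable_inner_L2[OF r r] integrable_inner_L2[OF r g] integrable_inner_L2[OF g g]
    by (simp add: L2_norm_power2 power2_norm_eq_inner)
  also have "\<dots> \<le> (L2_norm M r)\<^sup>2 + 2 * (L2_norm M r * L2_norm M g) + (L2_norm M g)\<^sup>2"
    using L2_Cauchy_Schwarz[OF r g] by linarith
  also have "\<dots> = (L2_norm M r + L2_norm M g)\<^sup>2" by (simp add: power2_sum)
  finally show ?thesis unfolding r_def by (rule power2_le_imp_le) (simp add: L2_norm_nonneg)
qed

lemma L2_norm_minus_commute: "L2_norm M (\<lambda>x. f x - g x) = L2_norm M (\<lambda>x. g x - f x)"
  by (simp add: L2_norm_def norm_minus_commute)

lemma L2_converges_norm:
  assumes "L2_converges M f g"
  shows "(\<lambda>n. L2_norm M (f n)) \<longlonglongrightarrow> L2_norm M g"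
proof (rule LIM_zero_cancel, rule Lim_null_comparison)
  have f: "f n \<in> L2 M" and g: "g \<in> L2 M" for n using assms by (auto simp: L2_converges_def)
  show "\<forall>\<^sub>F n in sequentially. norm (L2_norm M (f n) - L2_norm M g) \<le> L2_norm M (\<lambda>x. f n x - g x)"
    using L2_norm_triangle[OF f g] L2_norm_triangle[OF g f]
    by (intro always_eventually allI) (simp add: abs_le_iff L2_norm_minus_commute[of M g] algebra_simps)
  show "(\<lambda>n. L2_norm M (\<lambda>x. f n x - g x)) \<longlonglongrightarrow> 0" using assms by (simp add: L2_converges_def)
qed

lemma L2_converges_inner:
  assumes fg: "L2_converges M f g" and k: "k \<in> L2 M"
  shows "(\<lambda>n. integral\<^sup>L M (\<lambda>x. f n x \<bullet> k x)) \<longlonglongrightarrow> integral\<^sup>L M (\<lambda>x. g x \<bullet> k x)"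
proof (rule LIM_zero_cancel, rule Lim_null_comparison)
  have f: "f n \<in> L2 M" and g: "g \<in> L2 M" for n using fg by (auto simp: L2_converges_def)
  have "integral\<^sup>L M (\<lambda>x. f n x \<bullet> k x) - integral\<^sup>L M (\<lambda>x. g x \<bullet> k x) = integral\<^sup>L M (\<lambda>x. (f n x - g x) \<bullet> k x)" for n
    unfolding inner_diff_left
    by (rule Bochner_Integration.integral_diff[symmetric]) (intro integrable_inner_L2 f g k)+
  then show "\<forall>\<^sub>F n in sequentially. norm (integral\<^sup>L M (\<lambda>x. f n x \<bullet> k x) - integral\<^sup>L M (\<lambda>x. g x \<bullet> k x))
      \<le> L2_norm M (\<lambda>x. f n x - g x) * L2_norm M k"
    using L2_Cauchy_Schwarz[OF L2_diff[OF f g] k] by (intro always_eventually allI) simp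
  have "(\<lambda>n. L2_norm M (\<lambda>x. f n x - g x) * L2_norm M k) \<longlonglongrightarrow> 0 * L2_norm M k"
    using fg by (intro tendsto_intros) (simp add: L2_converges_def)
  then show "(\<lambda>n. L2_norm M (\<lambda>x. f n x - g x) * L2_norm M k) \<longlonglongrightarrow> 0" by simp
qed

lemma L2_converges_refl: "f \<in> L2 M \<Longrightarrow> L2_converges M (\<lambda>_. f) f"
  by (simp add: L2_converges_def L2_norm_def)

lemma L2_triangle:
  fixes f :: "real^2 \<Rightarrow> 'b::euclidean_space"
  shows "continuous_on UNIV f \<Longrightarrow> f \<in> L2 (lebesgue_on (triangle h))"
  unfolding L2_def using integrable_triangle[of f h] integrable_triangle[of "\<lambda>x. (norm (f x))\<^sup>2" h]
    continuous_on_power[OF continuous_on_norm, of UNIV f 2]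
  by auto

lemma L2_leg:
  fixes f :: "real^2 \<Rightarrow> real"
  shows "0 < h \<Longrightarrow> continuous_on UNIV f \<Longrightarrow> f \<in> L2 (surface_measure (leg h))"
  unfolding L2_def using integral_surface_measure_leg(1)[of h f] integral_surface_measure_leg(1)[of h "\<lambda>x. (norm (f x))\<^sup>2"]
    continuous_on_power[OF continuous_on_norm, of UNIV f 2]
  by auto

lemma weak_grad_unique:
  fixes w :: "real^2 \<Rightarrow> real"
  assumes G: "weak_grad (triangle h) w G" and H: "weak_grad (triangle h) w H"
  shows "AE x in lebesgue_on (triangle h). G x = H x"
proof -
  let ?M = "lebesgue_on (triangle h)"
  have "AE x in ?M. (G x - H x) \<bullet> b = 0" if b: "b \<in> Basis" for b
  proof (rule AE_zero_if_orthogonal_to_bumps[OF open_triangle])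
    have GH: "G \<in> L2 ?M" "H \<in> L2 ?M" "(\<lambda>_. b) \<in> L2 ?M"
      using G H by (auto simp: weak_grad_def intro: L2_triangle)
    have i: "integrable ?M (\<lambda>x. G x \<bullet> b)" "integrable ?M (\<lambda>x. H x \<bullet> b)"
      using GH by (auto intro: integrable_inner_L2)
    show "integrable ?M (\<lambda>x. (G x - H x) \<bullet> b)"
      unfolding inner_diff_left using i by (rule Bochner_Integration.integrable_diff)
    fix \<phi> :: "real^2 \<Rightarrow> real"
    assume \<phi>: "test_function (triangle h) \<phi>" "\<And>x. 0 \<le> \<phi> x \<and> \<phi> x \<le> 1" "\<phi> \<in> borel_measurable borel"
    have m: "\<phi> \<in> borel_measurable ?M"
      using \<phi>(3) by (intro measurable_restrict_space1 measurable_completion) simp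
    have ii: "integrable ?M (\<lambda>x. f x * \<phi> x)" if "integrable ?M f" for f
      by (rule Bochner_Integration.integrable_bound[OF that])
         (use that m \<phi>(2) in \<open>auto simp: abs_mult mult_left_le\<close>)
    have "integral\<^sup>L ?M (\<lambda>x. (G x - H x) \<bullet> b * \<phi> x) = integral\<^sup>L ?M (\<lambda>x. G x \<bullet> b * \<phi> x) - integral\<^sup>L ?M (\<lambda>x. H x \<bullet> b * \<phi> x)"
      unfolding inner_diff_left left_diff_distrib by (intro Bochner_Integration.integral_diff ii i)
    also have "\<dots> = 0"
      using G H \<phi>(1) b unfolding weak_grad_def by force
    finally show "integral\<^sup>L ?M (\<lambda>x. (G x - H x) \<bullet> b * \<phi> x) = 0" .
  qed
  then have "AE x in ?M. \<forall>b\<in>Basis. (G x - H x) \<bullet> b = 0"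
    by (subst AE_finite_all[OF finite_Basis]) blast
  then show ?thesis
    by eventually_elim (simp add: euclidean_eq_iff[of "G _"] inner_diff_left)
qed

text \<open>
Only boundary values of \<open>\<psi>\<close> remain after integrating along a line, and the sides do not belong to the
open triangle.
\<close>

lemma integral_partial_deriv_vanishing:
  fixes \<psi> :: "real^2 \<Rightarrow> real"
  assumes \<psi>: "smooth \<psi>" and zero: "\<And>x. x \<notin> triangle h \<Longrightarrow> \<psi> x = 0" and b: "b \<in> Basis"
  shows "integral\<^sup>L (lebesgue_on (triangle h)) (partial_deriv b \<psi>) = 0"
proof -
  have z: "\<psi> (vector [h, y]) = 0" "\<psi> (vector [y, y]) = 0" "\<psi> (vector [x, 0]) = 0" for x y
    by (auto intro!: zero simp: triangle_def)
  have c: "continuous_on UNIV (\<lambda>v. grad \<psi> v $ i)" for i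
    by (intro continuous_intros continuous_on_grad \<psi>)
  have "integral\<^sup>L (lebesgue_on (triangle h)) (\<lambda>v. grad \<psi> v $ 1) = 0"
    using integral_triangle_dx[of "\<lambda>x y. grad \<psi> (vector [x, y]) $ 1" "\<lambda>x y. \<psi> (vector [x, y])" h] c smooth_DERIV_fst[OF \<psi>]
    by (simp add: z)
  moreover have "integral\<^sup>L (lebesgue_on (triangle h)) (\<lambda>v. grad \<psi> v $ 2) = 0"
    using integral_triangle_dy[of "\<lambda>x y. grad \<psi> (vector [x, y]) $ 2" "\<lambda>x y. \<psi> (vector [x, y])" h] c smooth_DERIV_snd[OF \<psi>]
    by (simp add: z)
  moreover have "b = axis 1 1 \<or> b = axis 2 1"
    using b by (auto simp: Basis_vec_def) (metis exhaust_2)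
  ultimately show ?thesis by (auto simp: grad_nth)
qed

lemma weak_grad_smooth:
  fixes u :: "real^2 \<Rightarrow> real"
  assumes u: "smooth u"
  shows "weak_grad (triangle h) u (grad u)"
  unfolding weak_grad_def
proof (intro conjI allI impI ballI)
  show "u \<in> L2 (lebesgue_on (triangle h))" "grad u \<in> L2 (lebesgue_on (triangle h))"
    by (intro L2_triangle smooth_continuous continuous_on_grad u)+
  fix \<phi> :: "real^2 \<Rightarrow> real" and b :: "real^2"
  assume \<phi>: "test_function (triangle h) \<phi>" and b: "b \<in> Basis"
  then have s: "smooth \<phi>" and z: "\<And>x. x \<notin> triangle h \<Longrightarrow> \<phi> x = 0"
    unfolding test_function_def by blast+
  have "partial_deriv b (\<lambda>x. u x * \<phi> x) = (\<lambda>x. u x * partial_deriv b \<phi> x + (grad u x \<bullet> b) * \<phi> x)"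
    using b by (auto intro!: ext partial_derivI[OF has_derivative_mult] has_derivative_frechet smooth_differentiable u s simp: grad_inner)
  then have "0 = integral\<^sup>L (lebesgue_on (triangle h)) (\<lambda>x. u x * partial_deriv b \<phi> x + (grad u x \<bullet> b) * \<phi> x)"
    using integral_partial_deriv_vanishing[OF smooth_mult[OF u s] _ b, of h] z by simp
  also have "\<dots> = integral\<^sup>L (lebesgue_on (triangle h)) (\<lambda>x. u x * partial_deriv b \<phi> x) + integral\<^sup>L (lebesgue_on (triangle h)) (\<lambda>x. (grad u x \<bullet> b) * \<phi> x)"
    by (intro Bochner_Integration.integral_add integrable_triangle continuous_intros smooth_continuous smooth_continuous_partial continuous_on_grad u s b)
  finally show "integral\<^sup>L (lebesgue_on (triangle h)) (\<lambda>x. u x * partial_deriv b \<phi> x)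
      = - integral\<^sup>L (lebesgue_on (triangle h)) (\<lambda>x. (grad u x \<bullet> b) * \<phi> x)" by simp
qed

lemma has_trace_smooth:
  assumes "0 < h" "smooth u"
  shows "has_trace (triangle h) (leg h) u u"
  unfolding has_trace_def
  by (intro exI[of _ "grad u"] exI[of _ "\<lambda>_. u"] conjI allI weak_grad_smooth L2_converges_refl L2_triangle L2_leg
      smooth_continuous continuous_on_grad assms)

lemma mean_leg:
  assumes h: "0 < h"
  shows "mean (surface_measure (leg h)) g = integral\<^sup>L (surface_measure (leg h)) g / h"
proof -
  have "measure (surface_measure (leg h)) (space (surface_measure (leg h))) = integral\<^sup>L (surface_measure (leg h)) (\<lambda>_. 1)"
    by simp
  also have "\<dots> = h" using integral_surface_measure_leg(2)[OF h, of "\<lambda>_. 1"] h by simp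
  finally show ?thesis by (simp add: mean_def)
qed

lemma L2_norm_leg:
  assumes h: "0 < h" and f: "continuous_on UNIV f"
  shows "(L2_norm (surface_measure (leg h)) f)\<^sup>2 = ip h (\<lambda>y. f (leg_map h y)) (\<lambda>y. f (leg_map h y))"
  unfolding L2_norm_power2 ip_def
  using integral_surface_measure_leg(2)[OF h, of "\<lambda>x. (norm (f x))\<^sup>2"] f
  by (simp add: continuous_intros power2_eq_square)

context leg_mode begin

text \<open>
The limits of \<open>green_position\<close> and \<open>smooth_trace_inequality\<close> along the smooth functions that define the trace.
\<close>

lemma trace_estimates:
  assumes "has_trace (triangle h) (leg h) w g"
  obtains G where "weak_grad (triangle h) w G"
    "h * integral\<^sup>L (surface_measure (leg h)) g = integral\<^sup>L (lebesgue_on (triangle h)) (\<lambda>x. 2 * w x + G x \<bullet> x)"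
    "eigval * ((L2_norm (surface_measure (leg h)) g)\<^sup>2 - (integral\<^sup>L (surface_measure (leg h)) g)\<^sup>2 / h)
      \<le> (L2_norm (lebesgue_on (triangle h)) G)\<^sup>2"
proof -
  let ?M = "lebesgue_on (triangle h)" and ?S = "surface_measure (leg h)"
  obtain G \<phi> where G: "weak_grad (triangle h) w G" and \<phi>: "\<And>n. smooth (\<phi> n)"
    and lim: "L2_converges ?M \<phi> w" "L2_converges ?M (\<lambda>n. grad (\<phi> n)) G" "L2_converges ?S \<phi> g"
    using assms unfolding has_trace_def by blast
  have c: "continuous_on UNIV (\<phi> n)" for n using \<phi> by (rule smooth_continuous)
  have L2: "w \<in> L2 ?M" "G \<in> L2 ?M" using G by (auto simp: weak_grad_def)
  have one: "(\<lambda>_. 1::real) \<in> L2 ?M" "(\<lambda>_. 2::real) \<in> L2 ?M" "(\<lambda>x. x) \<in> L2 ?M" "(\<lambda>_. 1::real) \<in> L2 ?S"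
    by (auto intro!: L2_triangle L2_leg h continuous_intros)
  have int_g: "(\<lambda>n. integral\<^sup>L ?S (\<phi> n)) \<longlonglongrightarrow> integral\<^sup>L ?S g"
    using L2_converges_inner[OF lim(3) one(4)] by simp
  have eq: "h * integral\<^sup>L ?S (\<phi> n) = integral\<^sup>L ?M (\<lambda>x. \<phi> n x \<bullet> 2) + integral\<^sup>L ?M (\<lambda>x. grad (\<phi> n) x \<bullet> x)" for n
  proof -
    have "h * integral\<^sup>L ?S (\<phi> n) = integral\<^sup>L ?M (\<lambda>v. 2 * \<phi> n v + grad (\<phi> n) v \<bullet> v)"
      unfolding green_position[OF \<phi>] integral_surface_measure_leg(2)[OF h c] ..
    also have "\<dots> = integral\<^sup>L ?M (\<lambda>v. 2 * \<phi> n v) + integral\<^sup>L ?M (\<lambda>v. grad (\<phi> n) v \<bullet> v)"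
      by (intro Bochner_Integration.integral_add integrable_triangle continuous_intros c continuous_on_grad \<phi>)
    finally show ?thesis by (simp add: mult.commute)
  qed
  have "(\<lambda>n. h * integral\<^sup>L ?S (\<phi> n)) \<longlonglongrightarrow> integral\<^sup>L ?M (\<lambda>x. w x \<bullet> 2) + integral\<^sup>L ?M (\<lambda>x. G x \<bullet> x)"
    unfolding eq by (intro tendsto_add L2_converges_inner lim one)
  then have "h * integral\<^sup>L ?S g = integral\<^sup>L ?M (\<lambda>x. w x \<bullet> 2) + integral\<^sup>L ?M (\<lambda>x. G x \<bullet> x)"
    using LIMSEQ_unique tendsto_mult_left[OF int_g, of h] by blast
  also have "\<dots> = integral\<^sup>L ?M (\<lambda>x. w x \<bullet> 2 + G x \<bullet> x)"
    by (intro Bochner_Integration.integral_add[symmetric] integrable_inner_L2 L2 one)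
  finally have 1: "h * integral\<^sup>L ?S g = integral\<^sup>L ?M (\<lambda>x. 2 * w x + G x \<bullet> x)" by (simp add: mult.commute)
  have "eigval * ((L2_norm ?S (\<phi> n))\<^sup>2 - (integral\<^sup>L ?S (\<phi> n))\<^sup>2 / h) \<le> (L2_norm ?M (grad (\<phi> n)))\<^sup>2" for n
    using smooth_trace_inequality[OF \<phi>, of n]
    unfolding L2_norm_leg[OF h c] integral_surface_measure_leg(2)[OF h c] L2_norm_power2[of ?M] .
  moreover have "(\<lambda>n. eigval * ((L2_norm ?S (\<phi> n))\<^sup>2 - (integral\<^sup>L ?S (\<phi> n))\<^sup>2 / h))
      \<longlonglongrightarrow> eigval * ((L2_norm ?S g)\<^sup>2 - (integral\<^sup>L ?S g)\<^sup>2 / h)"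
    by (intro tendsto_intros L2_converges_norm lim int_g) (use h in auto)
  moreover have "(\<lambda>n. (L2_norm ?M (grad (\<phi> n)))\<^sup>2) \<longlonglongrightarrow> (L2_norm ?M G)\<^sup>2"
    by (intro tendsto_intros L2_converges_norm lim)
  ultimately have 2: "eigval * ((L2_norm ?S g)\<^sup>2 - (integral\<^sup>L ?S g)\<^sup>2 / h) \<le> (L2_norm ?M G)\<^sup>2"
    by (intro LIMSEQ_le) auto
  show ?thesis using that[OF G 1 2] .
qed

lemma eigval_powr: "eigval powr (- 1 / 2) = 1 / sqrt eigval"
  using eigval_pos by (simp add: powr_minus_divide powr_half_sqrt)

text \<open>
A mean-free trace of \<open>w\<close> is given, but the inequality concerns an arbitrary trace and an arbitrary weak
gradient. By uniqueness of the weak gradient the first trace estimate forces every trace of \<open>w\<close> to be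
mean-free, and all weak gradients have the same norm.
\<close>

lemma trace_inequality_eigval: "trace_inequality (triangle h) (leg h) (eigval powr (- 1 / 2))"
  unfolding trace_inequality_def
proof (intro ballI allI impI)
  let ?M = "lebesgue_on (triangle h)" and ?S = "surface_measure (leg h)"
  fix w g G
  assume w: "w \<in> H1_tilde (triangle h) (leg h)" and tr: "has_trace (triangle h) (leg h) w g" and G: "weak_grad (triangle h) w G"
  obtain g0 where g0: "has_trace (triangle h) (leg h) w g0" "mean ?S g0 = 0"
    using w unfolding H1_tilde_def by blast
  obtain G0 where G0: "weak_grad (triangle h) w G0" "h * integral\<^sup>L ?S g0 = integral\<^sup>L ?M (\<lambda>x. 2 * w x + G0 x \<bullet> x)"
    by (rule trace_estimates[OF g0(1)])
  obtain G1 where G1: "weak_grad (triangle h) w G1" "h * integral\<^sup>L ?S g = integral\<^sup>L ?M (\<lambda>x. 2 * w x + G1 x \<bullet> x)"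
     "eigval * ((L2_norm ?S g)\<^sup>2 - (integral\<^sup>L ?S g)\<^sup>2 / h) \<le> (L2_norm ?M G1)\<^sup>2"
    by (rule trace_estimates[OF tr])
  have m [measurable]: "w \<in> borel_measurable ?M" "G \<in> borel_measurable ?M" "G0 \<in> borel_measurable ?M" "G1 \<in> borel_measurable ?M"
      "(\<lambda>x. x) \<in> borel_measurable ?M"
    using G G0(1) G1(1) L2_triangle[of "\<lambda>x. x" h] by (auto simp: weak_grad_def L2_def)
  have "integral\<^sup>L ?M (\<lambda>x. 2 * w x + G1 x \<bullet> x) = integral\<^sup>L ?M (\<lambda>x. 2 * w x + G0 x \<bullet> x)"
    using weak_grad_unique[OF G1(1) G0(1)]
    by (intro integral_cong_AE) (auto elim!: eventually_mono)
  then have g_zero: "integral\<^sup>L ?S g = 0"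
    using G0(2) G1(2) g0(2) h by (simp add: mean_leg[OF h])
  have "integral\<^sup>L ?M (\<lambda>x. (norm (G1 x))\<^sup>2) = integral\<^sup>L ?M (\<lambda>x. (norm (G x))\<^sup>2)"
    using weak_grad_unique[OF G1(1) G]
    by (intro integral_cong_AE) (auto elim!: eventually_mono)
  then have "L2_norm ?M G1 = L2_norm ?M G" by (simp add: L2_norm_def)
  then have "eigval * (L2_norm ?S g)\<^sup>2 \<le> (L2_norm ?M G)\<^sup>2" using G1(3) g_zero by simp
  then have "(sqrt eigval * L2_norm ?S g)\<^sup>2 \<le> (L2_norm ?M G)\<^sup>2" using eigval_pos by (simp add: power_mult_distrib)
  then have "sqrt eigval * L2_norm ?S g \<le> L2_norm ?M G" by (rule power2_le_imp_le) (simp add: L2_norm_nonneg)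
  then show "L2_norm ?S g \<le> eigval powr (- 1 / 2) * L2_norm ?M G"
    unfolding eigval_powr using eigval_pos by (simp add: field_simps)
qed

text \<open>
The extremal function turns the inequality into an equality for the constant \<open>1 / sqrt eigval\<close>.
\<close>

lemma trace_inequality_lower_bound:
  assumes C: "trace_inequality (triangle h) (leg h) C"
  shows "eigval powr (- 1 / 2) \<le> C"
proof -
  let ?M = "lebesgue_on (triangle h)" and ?S = "surface_measure (leg h)"
  have c: "continuous_on UNIV (harmonic_mode k)" by (rule smooth_continuous[OF smooth_harmonic_mode])
  have tr: "has_trace (triangle h) (leg h) (harmonic_mode k) (harmonic_mode k)" by (rule has_trace_smooth[OF h smooth_harmonic_mode])
  have wg: "weak_grad (triangle h) (harmonic_mode k) (grad (harmonic_mode k))" by (rule weak_grad_smooth[OF smooth_harmonic_mode])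
  have "mean ?S (harmonic_mode k) = 0"
    by (simp add: mean_leg[OF h] integral_surface_measure_leg(2)[OF h c] harmonic_mode_k_leg mode_mean)
  then have "harmonic_mode k \<in> H1_tilde (triangle h) (leg h)" using tr wg unfolding H1_tilde_def H1_def by blast
  then have "L2_norm ?S (harmonic_mode k) \<le> C * L2_norm ?M (grad (harmonic_mode k))"
    using C tr wg unfolding trace_inequality_def by blast
  moreover have "L2_norm ?S (harmonic_mode k) = sqrt (ip h mode_trace mode_trace)"
    using L2_norm_leg[OF h c] L2_norm_nonneg[of ?S "harmonic_mode k"] unfolding harmonic_mode_k_leg by (metis real_sqrt_unique)
  moreover have "L2_norm ?M (grad (harmonic_mode k)) = sqrt eigval * sqrt (ip h mode_trace mode_trace)"
    by (simp add: L2_norm_def mode_energy real_sqrt_mult)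
  ultimately have "1 * sqrt (ip h mode_trace mode_trace) \<le> (C * sqrt eigval) * sqrt (ip h mode_trace mode_trace)" by simp
  then have "1 \<le> C * sqrt eigval" using mode_norm_pos by (subst (asm) mult_le_cancel_right_pos) auto
  then show ?thesis unfolding eigval_powr using eigval_pos by (simp add: divide_le_eq)
qed

lemma sharp_constant: "is_sharp_C2 (triangle h) (leg h) (eigval powr (- 1 / 2))"
  unfolding is_sharp_C2_def using trace_inequality_eigval trace_inequality_lower_bound by blast

end

theorem theorem3p2:
  fixes h :: real
  assumes "h > 0"
  shows "\<exists>z0. {z :: real. 0 < z \<and> z < pi \<and> tan z + tanh z = 0} = {z0}
    \<and> \<bar>z0 - 2.3650\<bar> \<le> 0.00005
    \<and> is_sharp_C2 {x :: real^2. 0 < x $ 2 \<and> x $ 2 < x $ 1 \<and> x $ 1 < h}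
                  {x :: real^2. x $ 1 = h \<and> 0 \<le> x $ 2 \<and> x $ 2 \<le> h}
                  ((z0 / h * tanh z0) powr (- 1 / 2))"
proof -
  obtain z0 :: real where z0: "{z. 0 < z \<and> z < pi \<and> tan z + tanh z = 0} = {z0}" "\<bar>z0 - 2.3650\<bar> \<le> 0.00005"
    "pi / 2 < z0" "z0 < pi" "sin z0 * cosh z0 + cos z0 * sinh z0 = 0"
    by (rule frequency_exists)
  interpret leg_mode h z0 using assms z0 by unfold_locales auto
  show ?thesis using z0 sharp_constant unfolding triangle_def leg_def eigval_def by blast
qed

end
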